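(* Let $\mathcal{S}=\{\mathcal{S}_0,\mathcal{S}_1,\mathcal{S}_2,\mathcal{S}_3\}$ be a finite simplicial complex of dimension $3$. For any nonsingular solution $\{r_i(t)\}_{i\in\mathcal{S}_0}$, $t\in[0,\infty)$, of the combinatorial Yamabe flow on $\mathcal{S}$ there is a number $k(\infty)$ such that the average scalar curvature $$k(t)=\frac{\sum_{i\in\mathcal{S}_0}K_i(t)r_i(t)}{\sum_{i\in\mathcal{S}_0}r_i(t)}$$ and all of the curvatures $K_i(t)$, $i\in\mathcal{S}_0$, converge to $k(\infty)$ as $t\to\infty$.
   Context: $\mathcal{S}_0$ is the set of vertices, $\mathcal{S}_1$ the set of edges, and $\mathcal{S}_3$ the set of tetrahedra $\{i,j,k,\ell\}$ of the complex. A metric structure is a function $r:\mathcal{S}_0\to(0,\infty)$; it assigns the length $\ell_{ij}=r_i+r_j$ to each edge $\{i,j\}\in\mathcal{S}_1$. For each tetrahedron put $$Q_{ijk\ell}=\Big(\frac1{r_i}+\frac1{r_j}+\frac1{r_k}+\frac1{r_\ell}\Big)^2-2\Big(\frac1{r_i^2}+\frac1{r_j^2}+\frac1{r_k^2}+\frac1{r_\ell^2}\Big).$$ The condition $Q_{ijk\ell}>0$ is the condition that $\{i,j,k,\ell\}$ is realized as a nondegenerate Euclidean tetrahedron with the prescribed edge lengths. For a nondegenerate Euclidean tetrahedron, $\alpha_{ijk\ell}$ denotes the solid angle at $i$ (the area of the spherical triangle cut out on the unit sphere centered at $i$), equal to the sum of the three dihedral angles along the edges at $i$ minus $\pi$.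 The curvature at the vertex $i$ is $$K_i=4\pi-\sum_{\{i,j,k,\ell\}\in\mathcal{S}_3}\alpha_{ijk\ell},$$ where the sum is over all tetrahedra containing $i$. The combinatorial Yamabe flow is the system $\frac{dr_i}{dt}=-K_ir_i$ for each $i\in\mathcal{S}_0$. A nonsingular solution is a family $\{r_i(t)\}_{i\in\mathcal{S}_0}$ for which there exists $\delta>0$ such that for all $t\in[0,\infty)$ the flow equations hold, $Q_{ijk\ell}>0$ for all $\{i,j,k,\ell\}\in\mathcal{S}_3$, and $$\frac{r_i}{\sum_{j\in\mathcal{S}_0}r_j}\ge\delta\quad\text{for each } i\in\mathcal{S}_0.$$ *)

theory Defs
  imports "HOL-Analysis.Analysis"
begin

subsection \<open>Finite abstract simplicial complexes\<close>

definition abstract_complex :: "'v set set \<Rightarrow> bool" where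
  "abstract_complex S \<longleftrightarrow>
     (\<forall>\<sigma>\<in>S. finite \<sigma> \<and> \<sigma> \<noteq> {}) \<and>
     (\<forall>\<sigma>\<in>S. \<forall>\<tau>. \<tau> \<noteq> {} \<and> \<tau> \<subseteq> \<sigma> \<longrightarrow> \<tau> \<in> S)"

definition simplices_of_dim :: "'v set set \<Rightarrow> nat \<Rightarrow> 'v set set" where
  "simplices_of_dim S n = {\<sigma> \<in> S. card \<sigma> = Suc n}"

(* The dimension is the maximal dimension of a simplex; the complex need not be pure. *)
definition complex_of_dim :: "'v set set \<Rightarrow> nat \<Rightarrow> bool" where
  "complex_of_dim S n \<longleftrightarrow>
     abstract_complex S \<and> simplices_of_dim S n \<noteq> {} \<and> (\<forall>\<sigma>\<in>S. card \<sigma> \<le> Suc n)"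

definition vertices :: "'v set set \<Rightarrow> 'v set" where
  "vertices S = {i. {i} \<in> S}"

abbreviation tetrahedra :: "'v set set \<Rightarrow> 'v set set" where
  "tetrahedra S \<equiv> simplices_of_dim S 3"


subsection \<open>Metric structures\<close>

definition metric_structure :: "'v set set \<Rightarrow> ('v \<Rightarrow> real) \<Rightarrow> bool" where
  "metric_structure S r \<longleftrightarrow> (\<forall>i\<in>vertices S. r i > 0)"

definition edge_length :: "('v \<Rightarrow> real) \<Rightarrow> 'v \<Rightarrow> 'v \<Rightarrow> real" where
  "edge_length r i j = r i + r j"

definition Q :: "('v \<Rightarrow> real) \<Rightarrow> 'v set \<Rightarrow> real" where
  "Q r \<sigma> = (\<Sum>i\<in>\<sigma>. 1 / r i)\<^sup>2 - 2 * (\<Sum>i\<in>\<sigma>. 1 / (r i)\<^sup>2)"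


subsection \<open>Dihedral and solid angles of Euclidean tetrahedra\<close>

definition vec_angle :: "'a::real_inner \<Rightarrow> 'a \<Rightarrow> real" where
  "vec_angle u v = arccos ((u \<bullet> v) / (norm u * norm v))"

definition orth_part :: "'a::real_inner \<Rightarrow> 'a \<Rightarrow> 'a" where
  "orth_part e u = u - ((u \<bullet> e) / (e \<bullet> e)) *\<^sub>R e"

(* The angle between the half-planes bounded by the line ab that contain c and d. *)
definition dihedral :: "'a::real_inner \<Rightarrow> 'a \<Rightarrow> 'a \<Rightarrow> 'a \<Rightarrow> real" where
  "dihedral a b c d = vec_angle (orth_part (b - a) (c - a)) (orth_part (b - a) (d - a))"

(* The dihedral angle of the tetrahedron with vertices p ` \<sigma> along the edge {i,j}; k and l are
   the other two vertices of \<sigma>, whose order is irrelevant. *)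
definition dihedral_angle :: "('v \<Rightarrow> 'a::real_inner) \<Rightarrow> 'v set \<Rightarrow> 'v \<Rightarrow> 'v \<Rightarrow> real" where
  "dihedral_angle p \<sigma> i j =
     (THE \<beta>. \<exists>k l. k \<noteq> l \<and> \<sigma> - {i, j} = {k, l} \<and> \<beta> = dihedral (p i) (p j) (p k) (p l))"

definition realizes :: "('v \<Rightarrow> real) \<Rightarrow> 'v set \<Rightarrow> ('v \<Rightarrow> real ^ 3) \<Rightarrow> bool" where
  "realizes r \<sigma> p \<longleftrightarrow>
     (\<forall>i\<in>\<sigma>. \<forall>j\<in>\<sigma>. i \<noteq> j \<longrightarrow> dist (p i) (p j) = edge_length r i j) \<and>
     \<not> affine_dependent (p ` \<sigma>)"

(* The three edges of a tetrahedron \<sigma> at i are indexed by j in \<sigma> - {i}. All realizations of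
   the given edge lengths are congruent, so the choice of p does not matter. *)
definition solid_angle :: "('v \<Rightarrow> real) \<Rightarrow> 'v set \<Rightarrow> 'v \<Rightarrow> real" where
  "solid_angle r \<sigma> i =
     (let p = (SOME p. realizes r \<sigma> p) in (\<Sum>j\<in>\<sigma> - {i}. dihedral_angle p \<sigma> i j) - pi)"

lemma dihedral_commute: "dihedral a b c d = dihedral a b d c"
  by (simp add: dihedral_def vec_angle_def inner_commute mult.commute)

lemma dihedral_angle_eq:
  assumes "distinct [i, j, k, l]"
  shows "dihedral_angle p {i, j, k, l} i j = dihedral (p i) (p j) (p k) (p l)"
  unfolding dihedral_angle_def
proof (rule the_equality)
  have kl: "{i, j, k, l} - {i, j} = {k, l}"
    using assms by auto
  then show "\<exists>k' l'. k' \<noteq> l' \<and> {i, j, k, l} - {i, j} = {k', l'} \<and>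
      dihedral (p i) (p j) (p k) (p l) = dihedral (p i) (p j) (p k') (p l')"
    using assms by auto
  show "\<beta> = dihedral (p i) (p j) (p k) (p l)"
    if "\<exists>k' l'. k' \<noteq> l' \<and> {i, j, k, l} - {i, j} = {k', l'} \<and>
      \<beta> = dihedral (p i) (p j) (p k') (p l')" for \<beta>
    using that unfolding kl by (auto simp: doubleton_eq_iff dihedral_commute)
qed

lemma solid_angle_eq:
  fixes r :: "'v \<Rightarrow> real"
  assumes "distinct [i, j, k, l]"
  defines "p \<equiv> SOME p. realizes r {i, j, k, l} p"
  shows "solid_angle r {i, j, k, l} i =
    dihedral (p i) (p j) (p k) (p l) + dihedral (p i) (p k) (p j) (p l)
      + dihedral (p i) (p l) (p j) (p k) - pi"
proof -
  have "{i, j, k, l} - {i} = {j, k, l}"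
    using assms by auto
  moreover have "dihedral_angle p {i, j, k, l} i j = dihedral (p i) (p j) (p k) (p l)"
    using assms by (intro dihedral_angle_eq) auto
  moreover have "dihedral_angle p {i, j, k, l} i k = dihedral (p i) (p k) (p j) (p l)"
    using dihedral_angle_eq[of i k j l p] assms by (auto simp: insert_commute)
  moreover have "dihedral_angle p {i, j, k, l} i l = dihedral (p i) (p l) (p j) (p k)"
    using dihedral_angle_eq[of i l j k p] assms by (auto simp: insert_commute)
  ultimately show ?thesis
    using assms(1) by (simp add: solid_angle_def Let_def p_def[symmetric])
qed


subsection \<open>Curvature and the combinatorial Yamabe flow\<close>

definition curvature :: "'v set set \<Rightarrow> ('v \<Rightarrow> real) \<Rightarrow> 'v \<Rightarrow> real" where
  "curvature S r i = 4 * pi - (\<Sum>\<sigma> | \<sigma> \<in> tetrahedra S \<and> i \<in> \<sigma>. solid_angle r \<sigma> i)"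

definition average_scalar_curvature :: "'v set set \<Rightarrow> ('v \<Rightarrow> real) \<Rightarrow> real" where
  "average_scalar_curvature S r =
     (\<Sum>i\<in>vertices S. curvature S r i * r i) / (\<Sum>i\<in>vertices S. r i)"

(* Only times t >= 0 matter; the derivative at t = 0 is the right derivative. *)
definition yamabe_flow :: "'v set set \<Rightarrow> (real \<Rightarrow> 'v \<Rightarrow> real) \<Rightarrow> bool" where
  "yamabe_flow S r \<longleftrightarrow>
     (\<forall>t\<ge>0. \<forall>i\<in>vertices S.
        ((\<lambda>s. r s i) has_real_derivative - curvature S (r t) i * r t i) (at t within {0..}))"

definition nonsingular_solution :: "'v set set \<Rightarrow> (real \<Rightarrow> 'v \<Rightarrow> real) \<Rightarrow> bool" where
  "nonsingular_solution S r \<longleftrightarrow>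
     (\<forall>t\<ge>0. metric_structure S (r t)) \<and> yamabe_flow S r \<and>
     (\<forall>t\<ge>0. \<forall>\<sigma>\<in>tetrahedra S. Q (r t) \<sigma> > 0) \<and>
     (\<exists>\<delta>>0. \<forall>t\<ge>0. \<forall>i\<in>vertices S. r t i / (\<Sum>j\<in>vertices S. r t j) \<ge> \<delta>)"

end

theory Submission
  imports Defs
begin

text \<open>
  By Schlaefli's formula the sum of \<open>\<alpha>\<^sub>i r\<^sub>i\<close> over the vertices of a tetrahedron varies as if the solid
  angles were constant. Hence, along the flow, the total curvature \<open>F = \<Sum> K\<^sub>i r\<^sub>i\<close> satisfies
  \<open>F' = - \<Sum> K\<^sub>i\<^sup>2 r\<^sub>i\<close>, and the average \<open>k\<close> satisfies \<open>k' = - \<Sum> (K\<^sub>i - k)\<^sup>2 x\<^sub>i\<close> with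
  \<open>x\<^sub>i = r\<^sub>i / \<Sum> r\<^sub>j \<ge> \<delta>\<close>. So \<open>k\<close> decreases; it is bounded, hence convergent, and \<open>K\<^sub>i - k\<close> is square
  integrable in time. It remains to see that \<open>K\<^sub>i - k\<close> is uniformly continuous, although the
  tetrahedra may degenerate in the limit. The cosines of the dihedral angles are homogeneous functions
  of the radii which are continuous on the whole positive orthant, because the faces never degenerate,
  and they lie in \<open>[-1, 1]\<close> along the flow. As the \<open>x\<^sub>i\<close> are Lipschitz in time with values in the compact
  interval \<open>[\<delta>, 1]\<close>, the dihedral angles are uniformly continuous in time.
\<close>

subsection \<open>Dihedral angles as functions of the radii\<close>

text \<open>
  The first two arguments are the radii at the ends of the edge, the other two those at the opposite
  vertices.
\<close>

definition edge_num :: "real \<Rightarrow> real \<Rightarrow> real \<Rightarrow> real \<Rightarrow> real" where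
  "edge_num a b c d = a * b * (a + b) * (c + d) - c * d * (a\<^sup>2 + b\<^sup>2)"

text \<open>By Heron's formula a face with radii \<open>a, b, c\<close> has squared area
  \<open>a * b * c * (a + b + c)\<close>, so \<open>(a * b)\<^sup>2 * edge_rad a b c d\<close> is
  the product of the squared areas of the two faces at the edge.\<close>

definition edge_rad :: "real \<Rightarrow> real \<Rightarrow> real \<Rightarrow> real \<Rightarrow> real" where
  "edge_rad a b c d = c * d * (a + b + c) * (a + b + d)"

text \<open>The cosine of the dihedral angle along the edge when the four spheres are mutually
  tangent. The formula makes sense for all positive radii, even where no tetrahedron exists.\<close>

definition edge_cos :: "real \<Rightarrow> real \<Rightarrow> real \<Rightarrow> real \<Rightarrow> real" where
  "edge_cos a b c d = edge_num a b c d / (2 * a * b * sqrt (edge_rad a b c d))"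

text \<open>\<open>quad_Q a b c d = 0\<close> is Descartes' relation for four mutually tangent
  circles in the plane.\<close>

definition quad_Q :: "real \<Rightarrow> real \<Rightarrow> real \<Rightarrow> real \<Rightarrow> real" where
  "quad_Q a b c d = (1/a + 1/b + 1/c + 1/d)\<^sup>2 - 2 * (1/a\<^sup>2 + 1/b\<^sup>2 + 1/c\<^sup>2 + 1/d\<^sup>2)"

lemma edge_rad_pos:
  assumes "a > 0" "b > 0" "c > 0" "d > 0"
  shows "edge_rad a b c d > 0"
  using assms by (simp add: edge_rad_def)

lemma quad_Q_poly:
  fixes a b c d :: real
  assumes "a \<noteq> 0" "b \<noteq> 0" "c \<noteq> 0" "d \<noteq> 0"
  shows "(a * b * c * d)\<^sup>2 * quad_Q a b c d =
    (b*c*d + a*c*d + a*b*d + a*b*c)\<^sup>2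
      - 2 * ((b*c*d)\<^sup>2 + (a*c*d)\<^sup>2 + (a*b*d)\<^sup>2 + (a*b*c)\<^sup>2)"
proof -
  have 1: "a*b*c*d * (1/a + 1/b + 1/c + 1/d) = b*c*d + a*c*d + a*b*d + a*b*c"
    using assms by (simp add: field_simps)
  have 2: "(a*b*c*d)\<^sup>2 * (1/a\<^sup>2 + 1/b\<^sup>2 + 1/c\<^sup>2 + 1/d\<^sup>2)
    = (b*c*d)\<^sup>2 + (a*c*d)\<^sup>2 + (a*b*d)\<^sup>2 + (a*b*c)\<^sup>2"
    using assms by (simp add: field_simps)
  have "(a * b * c * d)\<^sup>2 * quad_Q a b c d = (a*b*c*d * (1/a + 1/b + 1/c + 1/d))\<^sup>2
     - 2 * ((a*b*c*d)\<^sup>2 * (1/a\<^sup>2 + 1/b\<^sup>2 + 1/c\<^sup>2 + 1/d\<^sup>2))"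
    unfolding quad_Q_def by algebra
  then show ?thesis unfolding 1 2 .
qed

text \<open>The identity \<open>1 - cos^2 = sin^2\<close> for the dihedral angle, multiplied by the
  squared denominator of \<open>edge_cos\<close>. On the right, \<open>a + b\<close> is the edge
  length; the other factor, nine times the squared volume, is the same for all six edges.\<close>

lemma edge_sin_identity:
  fixes a b c d :: real
  assumes "a \<noteq> 0" "b \<noteq> 0" "c \<noteq> 0" "d \<noteq> 0"
  shows "4 * a\<^sup>2 * b\<^sup>2 * edge_rad a b c d - (edge_num a b c d)\<^sup>2 =
    (a + b)\<^sup>2 * ((a * b * c * d)\<^sup>2 * quad_Q a b c d)"
  unfolding quad_Q_poly[OF assms] edge_rad_def edge_num_def by algebra

lemma edge_cos_square:
  assumes "a > 0" "b > 0" "c > 0" "d > 0"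
  shows "1 - (edge_cos a b c d)\<^sup>2 =
    (c * d * (a + b))\<^sup>2 * quad_Q a b c d / (4 * edge_rad a b c d)"
proof -
  have P: "edge_rad a b c d > 0" using assms by (rule edge_rad_pos)
  have "(edge_cos a b c d)\<^sup>2 = (edge_num a b c d)\<^sup>2 / (4 * a\<^sup>2 * b\<^sup>2 * edge_rad a b c d)"
    using P by (simp add: edge_cos_def power_divide power_mult_distrib)
  then have "1 - (edge_cos a b c d)\<^sup>2 = (4 * a\<^sup>2 * b\<^sup>2 * edge_rad a b c d - (edge_num a b c d)\<^sup>2)
      / (4 * a\<^sup>2 * b\<^sup>2 * edge_rad a b c d)"
    using assms P by (simp add: diff_divide_distrib)
  also have "\<dots> = (a + b)\<^sup>2 * ((a * b * c * d)\<^sup>2 * quad_Q a b c d) / (4 * a\<^sup>2 * b\<^sup>2 * edge_rad a b c d)"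
    using assms by (simp add: edge_sin_identity)
  also have "\<dots> = (c * d * (a + b))\<^sup>2 * quad_Q a b c d / (4 * edge_rad a b c d)"
  proof -
    have "(a + b)\<^sup>2 * ((a * b * c * d)\<^sup>2 * quad_Q a b c d)
        = (a * b)\<^sup>2 * ((c * d * (a + b))\<^sup>2 * quad_Q a b c d)"
      by algebra
    moreover have "4 * a\<^sup>2 * b\<^sup>2 * edge_rad a b c d = (a * b)\<^sup>2 * (4 * edge_rad a b c d)"
      by algebra
    moreover have "(a * b)\<^sup>2 \<noteq> 0" using assms by simp
    ultimately show ?thesis by (metis mult_divide_mult_cancel_left)
  qed
  finally show ?thesis .
qed

section \<open>Dihedral angles of four mutually tangent spheres\<close>

lemma inner_orth_part:
  assumes "e \<noteq> 0"
  shows "orth_part e u \<bullet> orth_part e v = u \<bullet> v - (u \<bullet> e) * (v \<bullet> e) / (e \<bullet> e)"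
  using assms by (simp add: orth_part_def inner_diff_left inner_diff_right inner_commute)

lemma inner_of_dist:
  fixes x y z :: "'a::real_inner"
  shows "(y - x) \<bullet> (z - x) = ((dist x y)\<^sup>2 + (dist x z)\<^sup>2 - (dist y z)\<^sup>2) / 2"
  by (simp add: dist_norm power2_norm_eq_inner inner_diff_left inner_diff_right inner_commute)

lemma dihedral_tangent_spheres:
  fixes A B C D :: "'a::real_inner"
  assumes pos: "a > 0" "b > 0" "c > 0" "d > 0"
    and d: "dist A B = a + b" "dist A C = a + c" "dist A D = a + d"
      "dist B C = b + c" "dist B D = b + d" "dist C D = c + d"
  shows "dihedral A B C D = arccos (edge_cos a b c d)"
proof -
  define e u v where "e = B - A" and "u = C - A" and "v = D - A"
  have ee: "e \<bullet> e = (a + b)\<^sup>2"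
    using d(1) by (simp add: e_def power2_norm_eq_inner[symmetric] dist_norm norm_minus_commute)
  have ne: "e \<noteq> 0" using ee pos by auto
  have ab: "a + b \<noteq> 0" using pos by simp
  have ue: "u \<bullet> e = a\<^sup>2 + a*b + a*c - b*c"
    using inner_of_dist[of C A B] d unfolding u_def e_def
    by (simp add: dist_commute power2_eq_square algebra_simps)
  have ve: "v \<bullet> e = a\<^sup>2 + a*b + a*d - b*d"
    using inner_of_dist[of D A B] d unfolding v_def e_def
    by (simp add: dist_commute power2_eq_square algebra_simps)
  have uv: "u \<bullet> v = a\<^sup>2 + a*c + a*d - c*d"
    using inner_of_dist[of C A D] d unfolding u_def v_def
    by (simp add: dist_commute power2_eq_square algebra_simps)
  have uu: "u \<bullet> u = (a + c)\<^sup>2" and vv: "v \<bullet> v = (a + d)\<^sup>2"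
    using d by (simp_all add: u_def v_def power2_norm_eq_inner[symmetric] dist_norm norm_minus_commute)
  have UV: "orth_part e u \<bullet> orth_part e v = 2 * edge_num a b c d / (a + b)\<^sup>2"
  proof -
    have "(a + b)\<^sup>2 * (a\<^sup>2 + a*c + a*d - c*d) - (a\<^sup>2 + a*b + a*c - b*c) * (a\<^sup>2 + a*b + a*d - b*d)
        = 2 * edge_num a b c d"
      unfolding edge_num_def by algebra
    then show ?thesis
      unfolding inner_orth_part[OF ne] ue ve uv ee using ab by (simp add: field_simps)
  qed
  \<comment> \<open>By Heron's formula the right side is the squared height over the edge of the
    face with third radius \<open>z\<close>; it is applied with \<open>z = c\<close> and
    \<open>z = d\<close>.\<close>
  have *: "x - y * y / (a + b)\<^sup>2 = 4 * (a * b * z * (a + b + z)) / (a + b)\<^sup>2"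
    if "x = (a + z)\<^sup>2" "y = a\<^sup>2 + a*b + a*z - b*z" for x y z
  proof -
    have "(a + b)\<^sup>2 * x - y * y = 4 * (a * b * z * (a + b + z))"
      unfolding that by algebra
    then show ?thesis using ab by (simp add: field_simps)
  qed
  have "norm (orth_part e u) * norm (orth_part e v)
      = sqrt ((4 * (a * b * c * (a + b + c)) / (a + b)\<^sup>2) * (4 * (a * b * d * (a + b + d)) / (a + b)\<^sup>2))"
    unfolding norm_eq_sqrt_inner inner_orth_part[OF ne] ee *[OF uu ue] *[OF vv ve] real_sqrt_mult ..
  also have "(4 * (a * b * c * (a + b + c)) / (a + b)\<^sup>2) * (4 * (a * b * d * (a + b + d)) / (a + b)\<^sup>2)
      = (4 * a * b / (a + b)\<^sup>2)\<^sup>2 * edge_rad a b c d"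
    by (simp add: edge_rad_def power_divide power2_eq_square algebra_simps)
  also have "sqrt \<dots> = 4 * a * b / (a + b)\<^sup>2 * sqrt (edge_rad a b c d)"
    using pos by (simp add: real_sqrt_mult)
  finally have NN: "norm (orth_part e u) * norm (orth_part e v)
      = 4 * a * b / (a + b)\<^sup>2 * sqrt (edge_rad a b c d)" .
  have "sqrt (edge_rad a b c d) > 0" using edge_rad_pos[OF pos] by simp
  then have "(orth_part e u \<bullet> orth_part e v) / (norm (orth_part e u) * norm (orth_part e v))
      = edge_cos a b c d"
    unfolding UV NN edge_cos_def using ab pos by (simp add: field_simps)
  then show ?thesis
    by (simp add: dihedral_def vec_angle_def e_def u_def v_def)
qed

subsection \<open>Schlaefli's formula\<close>

text \<open>This identity removes the denominators \<open>a + b + c\<close> when the contributions of the three edges of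
  a face are added in Schlaefli's formula.\<close>

lemma edge_num_face_sum:
  "edge_num a b c d + edge_num a c b d + edge_num b c a d = 2 * a * b * c * (a + b + c)"
  unfolding edge_num_def by algebra

lemma edge_num_symmetric:
  "edge_num b a c d = edge_num a b c d" "edge_num a b d c = edge_num a b c d"
  unfolding edge_num_def by algebra+

text \<open>In the following, \<open>p, q, u, v\<close> are the logarithmic derivatives of the radii \<open>a, b, c, d\<close>.\<close>

definition edge_dnum where
  "edge_dnum a b c d p q u v =
    a * b * (p + q) * (a + b) * (c + d) + a * b * (a * p + b * q) * (c + d)
    + a * b * (a + b) * (c * u + d * v)
    - c * d * (u + v) * (a\<^sup>2 + b\<^sup>2) - 2 * c * d * (a\<^sup>2 * p + b\<^sup>2 * q :: real)"

text \<open>The derivative of \<open>edge_cos\<close> times its denominator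
  \<open>2 * a * b * sqrt (edge_rad a b c d)\<close>. The factor of \<open>edge_num\<close> is the
  logarithmic derivative of that denominator, to which \<open>edge_rad\<close> contributes half of
  its own.\<close>

definition edge_var where
  "edge_var a b c d p q u v = edge_dnum a b c d p q u v
     - edge_num a b c d * (p + q + (u + v
        + (a * p + b * q + c * u) / (a + b + c) + (a * p + b * q + d * v) / (a + b + d)) / 2)"

text \<open>Here \<open>s\<close> stands for the derivative of the semiperimeter
  \<open>a + b + c\<close> of a face; the quotient enters \<open>edge_var\<close> at each of the
  three edges of that face.\<close>

lemma face_cancel:
  assumes "a + b + c \<noteq> (0::real)"
  shows "edge_num a b c d * (s / (a + b + c)) + edge_num a c b d * (s / (a + b + c))
     + edge_num b c a d * (s / (a + b + c)) = 2 * a * b * c * s"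
proof -
  have "edge_num a b c d * (s / (a + b + c)) + edge_num a c b d * (s / (a + b + c))
     + edge_num b c a d * (s / (a + b + c)) = (2 * a * b * c * (a + b + c)) * (s / (a + b + c))"
    unfolding edge_num_face_sum[of a b c d, symmetric] distrib_right ..
  then show ?thesis using assms by simp
qed

text \<open>Schlaefli's formula cleared of denominators: each summand is, up to one common factor,
  an edge length times the derivative of its angle. The only fractions come from the four faces;
  \<open>face_cancel\<close> removes them and leaves a polynomial identity.\<close>

lemma edge_var_sum:
  assumes "a > 0" "b > 0" "c > 0" "d > 0"
  shows "edge_var a b c d p q u v + edge_var a c b d p u q v + edge_var a d b c p v q u
    + edge_var b c a d q u p v + edge_var b d a c q v p u + edge_var c d a b u v p q = 0"
proof -
  \<comment> \<open>\<open>F1\<close> to \<open>F4\<close> are the logarithmic derivatives of the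
    semiperimeters of the four faces. Kept opaque, each can be collected with the three edges of its
    face.\<close>
  define F1 F2 F3 F4 where "F1 = (a * p + b * q + c * u) / (a + b + c)"
    and "F2 = (a * p + b * q + d * v) / (a + b + d)"
    and "F3 = (a * p + c * u + d * v) / (a + c + d)"
    and "F4 = (b * q + c * u + d * v) / (b + c + d)"
  note F = F1_def F2_def F3_def F4_def
  define x1 x2 x3 x4 x5 x6 where "x1 = edge_num a b c d" and "x2 = edge_num a c b d"
    and "x3 = edge_num a d b c" and "x4 = edge_num b c a d" and "x5 = edge_num b d a c"
    and "x6 = edge_num c d a b"
  note x = x1_def x2_def x3_def x4_def x5_def x6_def
  have f1: "x1 * F1 + x2 * F1 + x4 * F1 = 2 * a * b * c * (a * p + b * q + c * u)"
    unfolding F x using assms by (intro face_cancel) simp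
  have f2: "x1 * F2 + x3 * F2 + x5 * F2 = 2 * a * b * d * (a * p + b * q + d * v)"
    unfolding F x using assms face_cancel[of a b d c] by (simp add: edge_num_symmetric)
  have f3: "x2 * F3 + x3 * F3 + x6 * F3 = 2 * a * c * d * (a * p + c * u + d * v)"
    unfolding F x using assms face_cancel[of a c d b] by (simp add: edge_num_symmetric)
  have f4: "x4 * F4 + x5 * F4 + x6 * F4 = 2 * b * c * d * (b * q + c * u + d * v)"
    unfolding F x using assms face_cancel[of b c d a] by (simp add: edge_num_symmetric)
  have v: "edge_var a b c d p q u v = edge_dnum a b c d p q u v - x1 * (p + q + (u + v + F1 + F2) / 2)"
    "edge_var a c b d p u q v = edge_dnum a c b d p u q v - x2 * (p + u + (q + v + F1 + F3) / 2)"
    "edge_var a d b c p v q u = edge_dnum a d b c p v q u - x3 * (p + v + (q + u + F2 + F3) / 2)"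
    "edge_var b c a d q u p v = edge_dnum b c a d q u p v - x4 * (q + u + (p + v + F1 + F4) / 2)"
    "edge_var b d a c q v p u = edge_dnum b d a c q v p u - x5 * (q + v + (p + u + F2 + F4) / 2)"
    "edge_var c d a b u v p q = edge_dnum c d a b u v p q - x6 * (u + v + (p + q + F3 + F4) / 2)"
    unfolding edge_var_def F x by (simp_all add: add_ac)
  \<comment> \<open>\<open>T\<close> collects everything without a face fraction.\<close>
  define T where "T = edge_dnum a b c d p q u v + edge_dnum a c b d p u q v + edge_dnum a d b c p v q u
    + edge_dnum b c a d q u p v + edge_dnum b d a c q v p u + edge_dnum c d a b u v p q
    - x1 * (p + q + (u + v) / 2) - x2 * (p + u + (q + v) / 2) - x3 * (p + v + (q + u) / 2)
    - x4 * (q + u + (p + v) / 2) - x5 * (q + v + (p + u) / 2) - x6 * (u + v + (p + q) / 2)"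
  have "edge_var a b c d p q u v + edge_var a c b d p u q v + edge_var a d b c p v q u
    + edge_var b c a d q u p v + edge_var b d a c q v p u + edge_var c d a b u v p q
    = T - ((x1 * F1 + x2 * F1 + x4 * F1) + (x1 * F2 + x3 * F2 + x5 * F2)
        + (x2 * F3 + x3 * F3 + x6 * F3) + (x4 * F4 + x5 * F4 + x6 * F4)) / 2"
    unfolding v T_def by (simp add: field_simps)
  also have "\<dots> = 0"
    unfolding f1 f2 f3 f4 unfolding T_def x edge_dnum_def edge_num_def by algebra
  finally show ?thesis .
qed

section \<open>Derivative of a single dihedral angle\<close>

lemma edge_cos_bounds:
  assumes "a > 0" "b > 0" "c > 0" "d > 0" "quad_Q a b c d > 0"
  shows "-1 < edge_cos a b c d" "edge_cos a b c d < 1"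
proof -
  have "1 - (edge_cos a b c d)\<^sup>2 > 0"
    using assms edge_rad_pos[of a b c d] by (simp add: edge_cos_square)
  then have "(edge_cos a b c d)\<^sup>2 < 1" by simp
  then show "-1 < edge_cos a b c d" "edge_cos a b c d < 1"
    using abs_square_less_1[of "edge_cos a b c d"] by auto
qed

text \<open>The root of \<open>edge_rad\<close> occurs in the denominators of both the derivative of
  the cosine and the sine, and cancels. Apart from \<open>A t + B t\<close>, the remaining
  denominator is symmetric in the four radii.\<close>

lemma edge_angle_derivative:
  fixes A B C D :: "real \<Rightarrow> real"
  assumes pos: "A t > 0" "B t > 0" "C t > 0" "D t > 0"
    and Q: "quad_Q (A t) (B t) (C t) (D t) > 0"
    and d: "(A has_real_derivative p * A t) (at t within X)"
       "(B has_real_derivative q * B t) (at t within X)"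
       "(C has_real_derivative u * C t) (at t within X)"
       "(D has_real_derivative v * D t) (at t within X)"
  shows "((\<lambda>t. arccos (edge_cos (A t) (B t) (C t) (D t))) has_real_derivative
     - edge_var (A t) (B t) (C t) (D t) p q u v /
       (A t * B t * C t * D t * (A t + B t) * sqrt (quad_Q (A t) (B t) (C t) (D t)))) (at t within X)"
proof -
  define a b c d where abcd: "a = A t" "b = B t" "c = C t" "d = D t"
  note pos' = pos[folded abcd] and Q' = Q[folded abcd]
  let ?P = "edge_rad a b c d" and ?n = "edge_num a b c d"
  \<comment> \<open>The derivative of \<open>edge_rad\<close>, written as \<open>?P\<close> times a
    logarithmic derivative because this is the form that enters \<open>edge_var\<close>.\<close>
  define dP where "dP = ?P * (u + v + (a * p + b * q + c * u) / (a + b + c) + (a * p + b * q + d * v) / (a + b + d))"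
  have P: "?P > 0" using pos' by (rule edge_rad_pos)
  have num: "((\<lambda>t. edge_num (A t) (B t) (C t) (D t)) has_real_derivative edge_dnum a b c d p q u v) (at t within X)"
    unfolding edge_num_def edge_dnum_def
    by (rule derivative_eq_intros d refl)+ (simp add: abcd power2_eq_square algebra_simps)
  have rad: "((\<lambda>t. edge_rad (A t) (B t) (C t) (D t)) has_real_derivative dP) (at t within X)"
  proof -
    have "dP = (c * d * (u + v)) * ((a + b + c) * (a + b + d))
        + c * d * ((a * p + b * q + c * u) * (a + b + d) + (a + b + c) * (a * p + b * q + d * v))"
    proof -
      have "c * d * F * G * (u + v + x / F + y / G) = c * d * (u + v) * (F * G) + c * d * (x * G + F * y)"
        if "F \<noteq> 0" "G \<noteq> 0" for F G x y
        using that by (simp add: field_simps)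
      then show ?thesis using pos' unfolding dP_def edge_rad_def by simp
    qed
    then show ?thesis
      unfolding edge_rad_def
      by - ((rule derivative_eq_intros d refl)+, simp add: abcd algebra_simps)
  qed
  have den: "((\<lambda>t. 2 * A t * B t * sqrt (edge_rad (A t) (B t) (C t) (D t))) has_real_derivative
      2 * a * b * sqrt ?P * (p + q + dP / ?P / 2)) (at t within X)"
  proof -
    have "((\<lambda>t. sqrt (edge_rad (A t) (B t) (C t) (D t))) has_real_derivative
       (inverse (sqrt ?P) / 2) * dP) (at t within X)"
      using DERIV_chain2[OF DERIV_real_sqrt rad] P by (simp add: abcd)
    moreover have "((\<lambda>t. 2 * A t * B t) has_real_derivative 2 * a * b * (p + q)) (at t within X)"
      by (rule derivative_eq_intros d refl)+ (simp add: abcd algebra_simps)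
    ultimately have "((\<lambda>t. 2 * A t * B t * sqrt (edge_rad (A t) (B t) (C t) (D t))) has_real_derivative
      2 * a * b * (p + q) * sqrt ?P + inverse (sqrt ?P) / 2 * dP * (2 * a * b)) (at t within X)"
      using DERIV_mult by (fastforce simp: abcd)
    moreover have "inverse (sqrt ?P) = sqrt ?P / ?P"
      using P by (simp add: field_simps)
    ultimately show ?thesis by (simp add: algebra_simps)
  qed
  have cosd: "((\<lambda>t. edge_cos (A t) (B t) (C t) (D t)) has_real_derivative
      edge_var a b c d p q u v / (2 * a * b * sqrt ?P)) (at t within X)"
  proof -
    have "((\<lambda>t. edge_cos (A t) (B t) (C t) (D t)) has_real_derivative
      (edge_dnum a b c d p q u v * (2 * a * b * sqrt ?P) - ?n * (2 * a * b * sqrt ?P * (p + q + dP / ?P / 2)))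
         / ((2 * a * b * sqrt ?P) * (2 * a * b * sqrt ?P))) (at t within X)"
      unfolding edge_cos_def using DERIV_divide[OF num den] P pos by (simp add: abcd)
    moreover have "(edge_dnum a b c d p q u v * (2 * a * b * sqrt ?P) - ?n * (2 * a * b * sqrt ?P * (p + q + dP / ?P / 2)))
         / ((2 * a * b * sqrt ?P) * (2 * a * b * sqrt ?P))
       = (edge_dnum a b c d p q u v - ?n * (p + q + dP / ?P / 2)) / (2 * a * b * sqrt ?P)"
    proof -
      have "(x * m - n * (m * y)) / (m * m) = (x - n * y) / m" if "m \<noteq> 0" for x m n y :: real
        using that by (simp add: field_simps)
      moreover have "2 * a * b * sqrt ?P \<noteq> 0" using P pos' by simp
      ultimately show ?thesis .
    qed
    moreover have "edge_dnum a b c d p q u v - ?n * (p + q + dP / ?P / 2) = edge_var a b c d p q u v"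
      using P by (simp add: edge_var_def dP_def)
    ultimately show ?thesis by simp
  qed
  have s: "1 - (edge_cos a b c d)\<^sup>2 = (c * d * (a + b))\<^sup>2 * quad_Q a b c d / (4 * ?P)"
    using pos' by (rule edge_cos_square)
  note lt = edge_cos_bounds[OF pos' Q']
  have sq: "sqrt (1 - (edge_cos a b c d)\<^sup>2) = c * d * (a + b) * sqrt (quad_Q a b c d) / (2 * sqrt ?P)"
    unfolding s using pos' by (simp add: real_sqrt_mult real_sqrt_divide)
  have "((\<lambda>t. arccos (edge_cos (A t) (B t) (C t) (D t))) has_real_derivative
      inverse (- sqrt (1 - (edge_cos a b c d)\<^sup>2)) * (edge_var a b c d p q u v / (2 * a * b * sqrt ?P))) (at t within X)"
    using DERIV_chain2[OF DERIV_arccos cosd] lt by (simp add: abcd)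
  moreover have "inverse (- sqrt (1 - (edge_cos a b c d)\<^sup>2)) * (edge_var a b c d p q u v / (2 * a * b * sqrt ?P))
     = - edge_var a b c d p q u v / (a * b * c * d * (a + b) * sqrt (quad_Q a b c d))"
    unfolding sq using pos' Q' P by (simp add: field_simps)
  ultimately show ?thesis by (simp only: abcd)
qed

subsection \<open>Realization of tetrahedra\<close>

text \<open>Explicit coordinates: \<open>A\<close> at the origin, \<open>B\<close> on the first
  axis, \<open>C\<close> in the plane of the first two axes, \<open>D\<close> above that
  plane.\<close>

lemma exists_tangent_spheres:
  assumes pos: "a > 0" "b > 0" "c > 0" "d > 0" and Q: "quad_Q a b c d > 0"
  shows "\<exists>A B C D :: real^3. dist A B = a + b \<and> dist A C = a + c \<and> dist A D = a + d \<and>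
      dist B C = b + c \<and> dist B D = b + d \<and> dist C D = c + d \<and> \<not> affine_dependent {A, B, C, D}"
proof -
  define e where "e = a + b"
  have e: "e > 0" using pos by (simp add: e_def)
  \<comment> \<open>\<open>x1\<close> and \<open>x2\<close> are the feet of the perpendiculars from
    \<open>C\<close> and \<open>D\<close> to the line \<open>AB\<close>, and \<open>y1\<close> is
    the height of \<open>C\<close>. \<open>y2\<close> gives \<open>C\<close> and \<open>D\<close>
    the right inner product; \<open>w\<close> is what the squared height of \<open>D\<close> over
    \<open>AB\<close> leaves for the third coordinate.\<close>
  define x1 x2 where "x1 = (a\<^sup>2 + a*b + a*c - b*c) / e" and "x2 = (a\<^sup>2 + a*b + a*d - b*d) / e"
  define y1 where "y1 = 2 * sqrt (a * b * c * (a + b + c)) / e"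
  define y2 where "y2 = edge_num a b c d / (e * sqrt (a * b * c * (a + b + c)))"
  define w where "w = 4 * (a * b * d * (a + b + d)) / e\<^sup>2 - y2\<^sup>2"
  define z2 where "z2 = sqrt w"
  have m: "a * b * c * (a + b + c) > 0" using pos by simp
  have y1: "y1 > 0" "y1\<^sup>2 = 4 * (a * b * c * (a + b + c)) / e\<^sup>2"
    using pos e m by (simp_all add: y1_def power_divide power_mult_distrib)
  have y2: "y2\<^sup>2 = (edge_num a b c d)\<^sup>2 / (e\<^sup>2 * (a * b * c * (a + b + c)))"
    using m unfolding y2_def power_divide power_mult_distrib by (simp only: real_sqrt_pow2 less_imp_le)
  have "w = (4 * (a * b * d * (a + b + d)) * (a * b * c * (a + b + c)) - (edge_num a b c d)\<^sup>2)
      / (e\<^sup>2 * (a * b * c * (a + b + c)))"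
  proof -
    have "x / s - n / (s * m) = (x * m - n) / (s * m)" if "s \<noteq> 0" "m \<noteq> 0" for x s n m :: real
      using that by (simp add: field_simps)
    then show ?thesis unfolding w_def y2 using m e by (metis less_irrefl zero_less_power)
  qed
  also have "4 * (a * b * d * (a + b + d)) * (a * b * c * (a + b + c)) = 4 * a\<^sup>2 * b\<^sup>2 * edge_rad a b c d"
    unfolding edge_rad_def by algebra
  \<comment> \<open>By \<open>edge_sin_identity\<close>, \<open>w\<close> is a positive multiple of
    \<open>quad_Q a b c d\<close>, so positivity of the latter lifts \<open>D\<close> off the plane
    \<open>ABC\<close>.\<close>
  finally have "w = e\<^sup>2 * ((a * b * c * d)\<^sup>2 * quad_Q a b c d) / (e\<^sup>2 * (a * b * c * (a + b + c)))"
    using pos edge_sin_identity[of a b c d] by (simp add: e_def)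
  then have "w > 0" using pos Q e m by simp
  then have z2: "z2 > 0" "z2\<^sup>2 = w" by (simp_all add: z2_def)
  have yy: "y1 * y2 = 2 * edge_num a b c d / e\<^sup>2"
  proof -
    define s where "s = sqrt (a * b * c * (a + b + c))"
    have "s > 0" using m unfolding s_def by (rule real_sqrt_gt_zero)
    then show ?thesis
      unfolding y1_def y2_def s_def[symmetric] using e by (simp add: field_simps power2_eq_square)
  qed
  have C2: "x1\<^sup>2 + y1\<^sup>2 = (a + c)\<^sup>2"
  proof -
    have "(a\<^sup>2 + a*b + a*c - b*c)\<^sup>2 + 4 * (a * b * c * (a + b + c)) = (a + c)\<^sup>2 * e\<^sup>2"
      unfolding e_def by algebra
    then show ?thesis unfolding x1_def y1 using e
      by (simp add: power_divide add_divide_distrib[symmetric])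
  qed
  have D2: "x2\<^sup>2 + y2\<^sup>2 + z2\<^sup>2 = (a + d)\<^sup>2"
  proof -
    have "(a\<^sup>2 + a*b + a*d - b*d)\<^sup>2 + 4 * (a * b * d * (a + b + d)) = (a + d)\<^sup>2 * e\<^sup>2"
      unfolding e_def by algebra
    then show ?thesis unfolding x2_def z2 w_def using e
      by (simp add: power_divide add_divide_distrib[symmetric])
  qed
  have x1e: "x1 * e = a\<^sup>2 + a*b + a*c - b*c" and x2e: "x2 * e = a\<^sup>2 + a*b + a*d - b*d"
    using e by (simp_all add: x1_def x2_def)
  have CD: "x1 * x2 + y1 * y2 = a\<^sup>2 + a*c + a*d - c*d"
  proof -
    have "(a\<^sup>2 + a*b + a*c - b*c) * (a\<^sup>2 + a*b + a*d - b*d) + 2 * edge_num a b c d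
        = (a\<^sup>2 + a*c + a*d - c*d) * e\<^sup>2"
      unfolding e_def edge_num_def by algebra
    then show ?thesis unfolding x1_def x2_def yy using e
      by (simp add: power2_eq_square add_divide_distrib[symmetric])
  qed
  define A B C D :: "real^3" where "A = vector [0, 0, 0]" and "B = vector [e, 0, 0]"
    and "C = vector [x1, y1, 0]" and "D = vector [x2, y2, z2]"
  note V = A_def B_def C_def D_def
  have dst: "dist X Y = l" if "l > 0" "(X$1 - Y$1)\<^sup>2 + (X$2 - Y$2)\<^sup>2 + (X$3 - Y$3)\<^sup>2 = l\<^sup>2" for X Y :: "real^3" and l
  proof -
    have "(dist X Y)\<^sup>2 = l\<^sup>2"
      using that(2) unfolding dist_norm power2_norm_eq_inner
      by (simp add: inner_vec_def sum_3 power2_eq_square)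
    then show ?thesis using that(1) by (simp add: power2_eq_iff_nonneg)
  qed
  have "dist A B = a + b"
    using e by (intro dst) (simp_all add: V e_def[symmetric])
  moreover have "dist A C = a + c"
    using pos C2 by (intro dst) (simp_all add: V)
  moreover have "dist A D = a + d"
    using pos D2 by (intro dst) (simp_all add: V)
  moreover have "dist B C = b + c"
  proof (rule dst)
    have "(e - x1)\<^sup>2 + y1\<^sup>2 = e\<^sup>2 + (x1\<^sup>2 + y1\<^sup>2) - 2 * (x1 * e)" by (simp add: power2_diff)
    then show "(B$1 - C$1)\<^sup>2 + (B$2 - C$2)\<^sup>2 + (B$3 - C$3)\<^sup>2 = (b + c)\<^sup>2"
      unfolding C2 x1e by (simp add: V e_def power2_eq_square algebra_simps)
  qed (use pos in simp)
  moreover have "dist B D = b + d"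
  proof (rule dst)
    have "(e - x2)\<^sup>2 + y2\<^sup>2 + z2\<^sup>2 = e\<^sup>2 + (x2\<^sup>2 + y2\<^sup>2 + z2\<^sup>2) - 2 * (x2 * e)" by (simp add: power2_diff)
    then show "(B$1 - D$1)\<^sup>2 + (B$2 - D$2)\<^sup>2 + (B$3 - D$3)\<^sup>2 = (b + d)\<^sup>2"
      unfolding D2 x2e by (simp add: V e_def power2_eq_square algebra_simps)
  qed (use pos in simp)
  moreover have "dist C D = c + d"
  proof (rule dst)
    have "(x1 - x2)\<^sup>2 + (y1 - y2)\<^sup>2 + z2\<^sup>2 = (x1\<^sup>2 + y1\<^sup>2) + (x2\<^sup>2 + y2\<^sup>2 + z2\<^sup>2) - 2 * (x1 * x2 + y1 * y2)"
      by (simp add: power2_diff)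
    then show "(C$1 - D$1)\<^sup>2 + (C$2 - D$2)\<^sup>2 + (C$3 - D$3)\<^sup>2 = (c + d)\<^sup>2"
      unfolding C2 D2 CD by (simp add: V power2_eq_square algebra_simps)
  qed (use pos in simp)
  moreover have "\<not> affine_dependent {A, B, C, D}"
  proof
    assume "affine_dependent {A, B, C, D}"
    then obtain U where U: "sum U {A, B, C, D} = 0" "\<exists>v\<in>{A, B, C, D}. U v \<noteq> 0"
      "(\<Sum>v\<in>{A, B, C, D}. U v *\<^sub>R v) = 0"
      by (subst (asm) affine_dependent_explicit_finite) auto
    have ne: "A \<noteq> B" "A \<noteq> C" "A \<noteq> D" "B \<noteq> C" "B \<noteq> D" "C \<noteq> D"
      using e y1 z2 by (auto simp: V vec_eq_iff forall_3)
    have z: "U A *\<^sub>R A + U B *\<^sub>R B + U C *\<^sub>R C + U D *\<^sub>R D = 0" and s: "U A + U B + U C + U D = 0"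
      using U(1,3) ne by (simp_all add: add.assoc)
    have "U A * A $ i + U B * B $ i + U C * C $ i + U D * D $ i = 0" for i
      using arg_cong[OF z, of "\<lambda>v. v $ i"] by simp
    \<comment> \<open>The coordinates are triangular: the coefficients of \<open>D\<close>,
      \<open>C\<close>, \<open>B\<close> vanish in this order, then that of \<open>A\<close> because
      the sum is zero.\<close>
    from this[of 1] this[of 2] this[of 3]
    have "U D * z2 = 0" "U C * y1 + U D * y2 = 0" "U B * e + U C * x1 + U D * x2 = 0"
      by (simp_all add: V)
    then have "U D = 0" "U C = 0" "U B = 0" using e y1 z2 by auto
    with s U(2) show False by auto
  qed
  ultimately show ?thesis by blast
qed

text \<open>Multiplication by the edge length removes the only asymmetric factor of the denominator,
  so that all six edges share the same \<open>N\<close> and their sum reduces to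
  \<open>edge_var_sum\<close>.\<close>

lemma edge_length_times_angle_derivative:
  fixes A B C D :: "real \<Rightarrow> real"
  assumes "A t > 0" "B t > 0" "C t > 0" "D t > 0"
    and "quad_Q (A t) (B t) (C t) (D t) > 0"
    and "(A has_real_derivative p * A t) (at t within X)"
       "(B has_real_derivative q * B t) (at t within X)"
       "(C has_real_derivative u * C t) (at t within X)"
       "(D has_real_derivative v * D t) (at t within X)"
    and N: "N = A t * B t * C t * D t * sqrt (quad_Q (A t) (B t) (C t) (D t))"
  obtains D' where "((\<lambda>t. arccos (edge_cos (A t) (B t) (C t) (D t))) has_real_derivative D') (at t within X)"
    "(A t + B t) * D' = - edge_var (A t) (B t) (C t) (D t) p q u v / N"
proof -
  define E where "E = edge_var (A t) (B t) (C t) (D t) p q u v"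
  define D' where "D' = - E / (A t * B t * C t * D t * (A t + B t) * sqrt (quad_Q (A t) (B t) (C t) (D t)))"
  have "D' = - E / ((A t + B t) * N)" unfolding D'_def N by (simp add: mult_ac)
  then have "(A t + B t) * D' = - E / N" using assms(1,2) by simp
  then show ?thesis
    using that edge_angle_derivative[OF assms(1-9)] unfolding E_def D'_def by blast
qed

section \<open>Solid angles in terms of the radii\<close>

lemma Q_tetrahedron:
  assumes "distinct [i, j, k, l]"
  shows "Q r {i, j, k, l} = quad_Q (r i) (r j) (r k) (r l)"
  using assms by (simp add: Q_def quad_Q_def add_ac)

text \<open>Guarantees that the choice operator in \<open>solid_angle\<close> picks a genuine
  realization.\<close>

lemma realizes_exists:
  fixes r :: "'v \<Rightarrow> real"
  assumes dist: "distinct [i, j, k, l]" and pos: "\<And>m. m \<in> {i, j, k, l} \<Longrightarrow> r m > 0"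
    and Q: "Q r {i, j, k, l} > 0"
  shows "\<exists>p. realizes r {i, j, k, l} p"
proof -
  obtain A B C D :: "real^3" where d: "dist A B = r i + r j" "dist A C = r i + r k"
    "dist A D = r i + r l" "dist B C = r j + r k" "dist B D = r j + r l" "dist C D = r k + r l"
    and ind: "\<not> affine_dependent {A, B, C, D}"
    using exists_tangent_spheres[of "r i" "r j" "r k" "r l"] pos Q
    unfolding Q_tetrahedron[OF dist] by auto
  define p where "p = (\<lambda>m. if m = i then A else if m = j then B else if m = k then C else D)"
  have p: "p i = A" "p j = B" "p k = C" "p l = D" using dist by (auto simp: p_def)
  have "realizes r {i, j, k, l} p"
    unfolding realizes_def edge_length_def using dist d ind by (auto simp: p dist_commute add.commute)
  then show ?thesis by blast
qed

text \<open>Only the pairwise distances of the chosen realization enter its dihedral angles, so the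
  choice drops out.\<close>

lemma solid_angle_formula:
  fixes r :: "'v \<Rightarrow> real"
  assumes dist: "distinct [i, j, k, l]" and pos: "\<And>m. m \<in> {i, j, k, l} \<Longrightarrow> r m > 0"
    and Q: "Q r {i, j, k, l} > 0"
  shows "solid_angle r {i, j, k, l} i = arccos (edge_cos (r i) (r j) (r k) (r l))
     + arccos (edge_cos (r i) (r k) (r j) (r l)) + arccos (edge_cos (r i) (r l) (r j) (r k)) - pi"
proof -
  define p where "p = (SOME p. realizes r {i, j, k, l} p)"
  have "realizes r {i, j, k, l} p"
    unfolding p_def using realizes_exists[OF assms] by (rule someI_ex)
  then have *: "dist (p m) (p n) = r m + r n" if "m \<in> {i, j, k, l}" "n \<in> {i, j, k, l}" "m \<noteq> n" for m n
    using that by (auto simp: realizes_def edge_length_def)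
  have "dihedral (p i) (p j) (p k) (p l) = arccos (edge_cos (r i) (r j) (r k) (r l))"
    "dihedral (p i) (p k) (p j) (p l) = arccos (edge_cos (r i) (r k) (r j) (r l))"
    "dihedral (p i) (p l) (p j) (p k) = arccos (edge_cos (r i) (r l) (r j) (r k))"
    using dist by (intro dihedral_tangent_spheres pos *; auto)+
  then show ?thesis
    unfolding solid_angle_eq[OF dist, of r, folded p_def] by simp
qed

lemma edge_cos_symmetric:
  "edge_cos b a c d = edge_cos a b c d" "edge_cos a b d c = edge_cos a b c d"
  by (simp_all add: edge_cos_def edge_num_symmetric edge_rad_def ac_simps)

lemma card_4_obtain:
  assumes "card \<sigma> = 4" "i \<in> \<sigma>"
  obtains j k l where "\<sigma> = {i, j, k, l}" "distinct [i, j, k, l]"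
proof -
  have "card (\<sigma> - {i}) = 3" using assms by simp
  then obtain j k l where jkl: "\<sigma> - {i} = {j, k, l}" "j \<noteq> k" "j \<noteq> l" "k \<noteq> l"
    unfolding card_3_iff by blast
  have "\<sigma> = {i, j, k, l}" using jkl(1) assms(2) by blast
  moreover have "i \<notin> {j, k, l}" unfolding jkl(1)[symmetric] by simp
  ultimately show ?thesis using that jkl(2-4) by simp
qed

text \<open>Each dihedral angle counts at both ends of its edge. The weights \<open>w\<close> stay
  free because two instances occur: the radii, which give edge lengths as coefficients, and the
  derivatives of the radii.\<close>

lemma sum_solid_angle:
  fixes r :: "'v \<Rightarrow> real"
  assumes dist: "distinct [i, j, k, l]" and pos: "\<And>m. m \<in> {i, j, k, l} \<Longrightarrow> r m > 0"
    and Q: "Q r {i, j, k, l} > 0"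
  shows "(\<Sum>m\<in>{i, j, k, l}. solid_angle r {i, j, k, l} m * w m) =
     (w i + w j) * arccos (edge_cos (r i) (r j) (r k) (r l))
     + (w i + w k) * arccos (edge_cos (r i) (r k) (r j) (r l))
     + (w i + w l) * arccos (edge_cos (r i) (r l) (r j) (r k))
     + (w j + w k) * arccos (edge_cos (r j) (r k) (r i) (r l))
     + (w j + w l) * arccos (edge_cos (r j) (r l) (r i) (r k))
     + (w k + w l) * arccos (edge_cos (r k) (r l) (r i) (r j))
     - pi * (w i + w j + w k + w l)"
proof -
  let ?s = "{i, j, k, l}"
  have s: "?s = {j, i, k, l}" "?s = {k, i, j, l}" "?s = {l, i, j, k}" by auto
  have i: "solid_angle r ?s i = arccos (edge_cos (r i) (r j) (r k) (r l))
     + arccos (edge_cos (r i) (r k) (r j) (r l)) + arccos (edge_cos (r i) (r l) (r j) (r k)) - pi"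
    using assms by (rule solid_angle_formula)
  have j: "solid_angle r ?s j = arccos (edge_cos (r j) (r i) (r k) (r l))
     + arccos (edge_cos (r j) (r k) (r i) (r l)) + arccos (edge_cos (r j) (r l) (r i) (r k)) - pi"
    unfolding s(1) using dist pos Q unfolding s(1) by (intro solid_angle_formula) auto
  have k: "solid_angle r ?s k = arccos (edge_cos (r k) (r i) (r j) (r l))
     + arccos (edge_cos (r k) (r j) (r i) (r l)) + arccos (edge_cos (r k) (r l) (r i) (r j)) - pi"
    unfolding s(2) using dist pos Q unfolding s(2) by (intro solid_angle_formula) auto
  have l: "solid_angle r ?s l = arccos (edge_cos (r l) (r i) (r j) (r k))
     + arccos (edge_cos (r l) (r j) (r i) (r k)) + arccos (edge_cos (r l) (r k) (r i) (r j)) - pi"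
    unfolding s(3) using dist pos Q unfolding s(3) by (intro solid_angle_formula) auto
  have "(\<Sum>m\<in>?s. solid_angle r ?s m * w m) = solid_angle r ?s i * w i + solid_angle r ?s j * w j
     + solid_angle r ?s k * w k + solid_angle r ?s l * w l"
    using dist by (simp add: add.assoc)
  also have "\<dots> = (w i + w j) * arccos (edge_cos (r i) (r j) (r k) (r l))
     + (w i + w k) * arccos (edge_cos (r i) (r k) (r j) (r l))
     + (w i + w l) * arccos (edge_cos (r i) (r l) (r j) (r k))
     + (w j + w k) * arccos (edge_cos (r j) (r k) (r i) (r l))
     + (w j + w l) * arccos (edge_cos (r j) (r l) (r i) (r k))
     + (w k + w l) * arccos (edge_cos (r k) (r l) (r i) (r j))
     - pi * (w i + w j + w k + w l)"
    unfolding i j k l edge_cos_symmetric(1)[of "r i"] edge_cos_symmetric(1)[of "r j" "r k"]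
      edge_cos_symmetric(1)[of "r j" "r l"] edge_cos_symmetric(1)[of "r k" "r l"]
    by (simp add: algebra_simps)
  finally show ?thesis .
qed

subsection \<open>Variation and continuity of solid angles\<close>

text \<open>By the product rule the derivative is the stated sum plus the sum of edge lengths times
  angle derivatives, which vanishes by Schlaefli's formula.\<close>

lemma weighted_solid_angle_derivative:
  fixes r :: "real \<Rightarrow> 'v \<Rightarrow> real"
  assumes card: "card \<sigma> = 4" and t: "t \<in> X"
    and pos: "\<And>s m. s \<in> X \<Longrightarrow> m \<in> \<sigma> \<Longrightarrow> r s m > 0"
    and Q: "\<And>s. s \<in> X \<Longrightarrow> Q (r s) \<sigma> > 0"
    and d: "\<And>m. m \<in> \<sigma> \<Longrightarrow> ((\<lambda>s. r s m) has_real_derivative p m * r t m) (at t within X)"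
  shows "((\<lambda>s. \<Sum>m\<in>\<sigma>. solid_angle (r s) \<sigma> m * r s m) has_real_derivative
     (\<Sum>m\<in>\<sigma>. solid_angle (r t) \<sigma> m * (p m * r t m))) (at t within X)"
proof -
  obtain i j k l where \<sigma>: "\<sigma> = {i, j, k, l}" and dist: "distinct [i, j, k, l]"
    using card card_4_obtain by (metis card.empty equals0I zero_neq_numeral)
  have pos': "r s i > 0" "r s j > 0" "r s k > 0" "r s l > 0" if "s \<in> X" for s
    using pos that by (auto simp: \<sigma>)
  have d': "((\<lambda>s. r s i) has_real_derivative p i * r t i) (at t within X)"
     "((\<lambda>s. r s j) has_real_derivative p j * r t j) (at t within X)"
     "((\<lambda>s. r s k) has_real_derivative p k * r t k) (at t within X)"
     "((\<lambda>s. r s l) has_real_derivative p l * r t l) (at t within X)"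
    using d by (auto simp: \<sigma>)
  note P = pos'[OF t]
  have q: "quad_Q (r t i) (r t j) (r t k) (r t l) > 0"
    using Q[OF t] by (simp only: \<sigma> Q_tetrahedron[OF dist])
  define N where "N = r t i * r t j * r t k * r t l * sqrt (quad_Q (r t i) (r t j) (r t k) (r t l))"
  \<comment> \<open>Symmetry of \<open>quad_Q\<close> lets the six orderings below share one
    \<open>N\<close>.\<close>
  have q': "quad_Q (r t i) (r t k) (r t j) (r t l) = quad_Q (r t i) (r t j) (r t k) (r t l)"
    "quad_Q (r t i) (r t l) (r t j) (r t k) = quad_Q (r t i) (r t j) (r t k) (r t l)"
    "quad_Q (r t j) (r t k) (r t i) (r t l) = quad_Q (r t i) (r t j) (r t k) (r t l)"
    "quad_Q (r t j) (r t l) (r t i) (r t k) = quad_Q (r t i) (r t j) (r t k) (r t l)"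
    "quad_Q (r t k) (r t l) (r t i) (r t j) = quad_Q (r t i) (r t j) (r t k) (r t l)"
    by (simp_all add: quad_Q_def add_ac)
  obtain D1 where D1: "((\<lambda>s. arccos (edge_cos (r s i) (r s j) (r s k) (r s l))) has_real_derivative D1) (at t within X)"
     "(r t i + r t j) * D1 = - edge_var (r t i) (r t j) (r t k) (r t l) (p i) (p j) (p k) (p l) / N"
    by (rule edge_length_times_angle_derivative[where N = N, OF P(1) P(2) P(3) P(4) _ d'(1) d'(2) d'(3) d'(4)])
      (use q in \<open>simp_all add: N_def\<close>)
  obtain D2 where D2: "((\<lambda>s. arccos (edge_cos (r s i) (r s k) (r s j) (r s l))) has_real_derivative D2) (at t within X)"
     "(r t i + r t k) * D2 = - edge_var (r t i) (r t k) (r t j) (r t l) (p i) (p k) (p j) (p l) / N"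
    by (rule edge_length_times_angle_derivative[where N = N, OF P(1) P(3) P(2) P(4) _ d'(1) d'(3) d'(2) d'(4)])
      (use q in \<open>simp_all add: N_def q' mult_ac\<close>)
  obtain D3 where D3: "((\<lambda>s. arccos (edge_cos (r s i) (r s l) (r s j) (r s k))) has_real_derivative D3) (at t within X)"
     "(r t i + r t l) * D3 = - edge_var (r t i) (r t l) (r t j) (r t k) (p i) (p l) (p j) (p k) / N"
    by (rule edge_length_times_angle_derivative[where N = N, OF P(1) P(4) P(2) P(3) _ d'(1) d'(4) d'(2) d'(3)])
      (use q in \<open>simp_all add: N_def q' mult_ac\<close>)
  obtain D4 where D4: "((\<lambda>s. arccos (edge_cos (r s j) (r s k) (r s i) (r s l))) has_real_derivative D4) (at t within X)"
     "(r t j + r t k) * D4 = - edge_var (r t j) (r t k) (r t i) (r t l) (p j) (p k) (p i) (p l) / N"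
    by (rule edge_length_times_angle_derivative[where N = N, OF P(2) P(3) P(1) P(4) _ d'(2) d'(3) d'(1) d'(4)])
      (use q in \<open>simp_all add: N_def q' mult_ac\<close>)
  obtain D5 where D5: "((\<lambda>s. arccos (edge_cos (r s j) (r s l) (r s i) (r s k))) has_real_derivative D5) (at t within X)"
     "(r t j + r t l) * D5 = - edge_var (r t j) (r t l) (r t i) (r t k) (p j) (p l) (p i) (p k) / N"
    by (rule edge_length_times_angle_derivative[where N = N, OF P(2) P(4) P(1) P(3) _ d'(2) d'(4) d'(1) d'(3)])
      (use q in \<open>simp_all add: N_def q' mult_ac\<close>)
  obtain D6 where D6: "((\<lambda>s. arccos (edge_cos (r s k) (r s l) (r s i) (r s j))) has_real_derivative D6) (at t within X)"
     "(r t k + r t l) * D6 = - edge_var (r t k) (r t l) (r t i) (r t j) (p k) (p l) (p i) (p j) / N"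
    by (rule edge_length_times_angle_derivative[where N = N, OF P(3) P(4) P(1) P(2) _ d'(3) d'(4) d'(1) d'(2)])
      (use q in \<open>simp_all add: N_def q' mult_ac\<close>)
  \<comment> \<open>Over the common denominator \<open>N\<close> the numerators add up to zero by
    \<open>edge_var_sum\<close>.\<close>
  have schlaefli: "(r t i + r t j) * D1 + (r t i + r t k) * D2 + (r t i + r t l) * D3
      + (r t j + r t k) * D4 + (r t j + r t l) * D5 + (r t k + r t l) * D6 = 0"
    unfolding D1(2) D2(2) D3(2) D4(2) D5(2) D6(2) add_divide_distrib[symmetric] minus_add_distrib[symmetric]
      edge_var_sum[OF P] by simp
  define f where "f = (\<lambda>s. (r s i + r s j) * arccos (edge_cos (r s i) (r s j) (r s k) (r s l))
     + (r s i + r s k) * arccos (edge_cos (r s i) (r s k) (r s j) (r s l))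
     + (r s i + r s l) * arccos (edge_cos (r s i) (r s l) (r s j) (r s k))
     + (r s j + r s k) * arccos (edge_cos (r s j) (r s k) (r s i) (r s l))
     + (r s j + r s l) * arccos (edge_cos (r s j) (r s l) (r s i) (r s k))
     + (r s k + r s l) * arccos (edge_cos (r s k) (r s l) (r s i) (r s j))
     - pi * (r s i + r s j + r s k + r s l))"
  have edge: "((\<lambda>s. (r s a + r s b) * g s) has_real_derivative
      (p a * r t a + p b * r t b) * g t + (r t a + r t b) * G) (at t within X)"
    if "a \<in> \<sigma>" "b \<in> \<sigma>" "(g has_real_derivative G) (at t within X)" for a b g G
    using DERIV_mult[OF DERIV_add[OF d[OF that(1)] d[OF that(2)]] that(3)] by (simp only: mult.commute[of G])
  have \<sigma>i: "i \<in> \<sigma>" "j \<in> \<sigma>" "k \<in> \<sigma>" "l \<in> \<sigma>" by (simp_all add: \<sigma>)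
  note f' = DERIV_diff[OF DERIV_add[OF DERIV_add[OF DERIV_add[OF DERIV_add[OF DERIV_add[OF
      edge[OF \<sigma>i(1,2) D1(1)] edge[OF \<sigma>i(1,3) D2(1)]] edge[OF \<sigma>i(1,4) D3(1)]] edge[OF \<sigma>i(2,3) D4(1)]]
      edge[OF \<sigma>i(2,4) D5(1)]] edge[OF \<sigma>i(3,4) D6(1)]]
      DERIV_cmult[OF DERIV_add[OF DERIV_add[OF DERIV_add[OF d'(1) d'(2)] d'(3)] d'(4)], of pi]]
  have "(f has_real_derivative (\<Sum>m\<in>\<sigma>. solid_angle (r t) \<sigma> m * (p m * r t m))
     + ((r t i + r t j) * D1 + (r t i + r t k) * D2 + (r t i + r t l) * D3
      + (r t j + r t k) * D4 + (r t j + r t l) * D5 + (r t k + r t l) * D6)) (at t within X)"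
    unfolding f_def
  proof (rule DERIV_cong[OF f'])
    have "(\<Sum>m\<in>\<sigma>. solid_angle (r t) \<sigma> m * (p m * r t m)) =
     (p i * r t i + p j * r t j) * arccos (edge_cos (r t i) (r t j) (r t k) (r t l))
     + (p i * r t i + p k * r t k) * arccos (edge_cos (r t i) (r t k) (r t j) (r t l))
     + (p i * r t i + p l * r t l) * arccos (edge_cos (r t i) (r t l) (r t j) (r t k))
     + (p j * r t j + p k * r t k) * arccos (edge_cos (r t j) (r t k) (r t i) (r t l))
     + (p j * r t j + p l * r t l) * arccos (edge_cos (r t j) (r t l) (r t i) (r t k))
     + (p k * r t k + p l * r t l) * arccos (edge_cos (r t k) (r t l) (r t i) (r t j))
     - pi * (p i * r t i + p j * r t j + p k * r t k + p l * r t l)" (is "?L = ?R")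
      using sum_solid_angle[OF dist pos[unfolded \<sigma>, OF t] Q[unfolded \<sigma>, OF t], of "\<lambda>m. p m * r t m"]
      by (simp only: \<sigma>)
    then show "(p i * r t i + p j * r t j) * arccos (edge_cos (r t i) (r t j) (r t k) (r t l)) + (r t i + r t j) * D1
     + ((p i * r t i + p k * r t k) * arccos (edge_cos (r t i) (r t k) (r t j) (r t l)) + (r t i + r t k) * D2)
     + ((p i * r t i + p l * r t l) * arccos (edge_cos (r t i) (r t l) (r t j) (r t k)) + (r t i + r t l) * D3)
     + ((p j * r t j + p k * r t k) * arccos (edge_cos (r t j) (r t k) (r t i) (r t l)) + (r t j + r t k) * D4)
     + ((p j * r t j + p l * r t l) * arccos (edge_cos (r t j) (r t l) (r t i) (r t k)) + (r t j + r t l) * D5)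
     + ((p k * r t k + p l * r t l) * arccos (edge_cos (r t k) (r t l) (r t i) (r t j)) + (r t k + r t l) * D6)
     - pi * (p i * r t i + p j * r t j + p k * r t k + p l * r t l) =
     ?L + ((r t i + r t j) * D1 + (r t i + r t k) * D2 + (r t i + r t l) * D3
      + (r t j + r t k) * D4 + (r t j + r t l) * D5 + (r t k + r t l) * D6)" by linarith
  qed
  then have "(f has_real_derivative (\<Sum>m\<in>\<sigma>. solid_angle (r t) \<sigma> m * (p m * r t m))) (at t within X)"
    unfolding schlaefli by simp
  \<comment> \<open>The angle formula is known only on \<open>X\<close>, which suffices for a
    derivative within \<open>X\<close>.\<close>
  moreover have "f s = (\<Sum>m\<in>\<sigma>. solid_angle (r s) \<sigma> m * r s m)" if "s \<in> X" for s
    unfolding f_def \<sigma> using dist pos Q that by (intro sum_solid_angle[symmetric]) (auto simp: \<sigma>)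
  ultimately show ?thesis
    using t has_field_derivative_transform_within[of f _ t X 1] by simp
qed

text \<open>Numerator and denominator are both homogeneous of degree 4. Hence the radii, which may
  grow or shrink without bound, can be replaced by their shares of the total.\<close>

lemma edge_cos_scale:
  assumes "R > 0"
  shows "edge_cos (a / R) (b / R) (c / R) (d / R) = edge_cos a b c d"
proof -
  have 1: "edge_num (a / R) (b / R) (c / R) (d / R) = edge_num a b c d / R^4"
    using assms by (simp add: edge_num_def field_simps power4_eq_xxxx power2_eq_square)
  have "edge_rad (a / R) (b / R) (c / R) (d / R) = edge_rad a b c d / (R\<^sup>2)\<^sup>2"
    using assms by (simp add: edge_rad_def field_simps power2_eq_square)
  moreover have "sqrt ((R\<^sup>2)\<^sup>2) = R\<^sup>2" by (rule real_sqrt_unique) auto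
  ultimately have 2: "sqrt (edge_rad (a / R) (b / R) (c / R) (d / R)) = sqrt (edge_rad a b c d) / R\<^sup>2"
    by (simp only: real_sqrt_divide)
  show ?thesis
    unfolding edge_cos_def 1 2 using assms by (simp add: power4_eq_xxxx power2_eq_square)
qed

section \<open>Uniform continuity and bounds of the angles\<close>

lemma uniformly_continuous_on_Pair:
  fixes f :: "'a::metric_space \<Rightarrow> 'b::metric_space" and g :: "'a \<Rightarrow> 'c::metric_space"
  assumes "uniformly_continuous_on S f" "uniformly_continuous_on S g"
  shows "uniformly_continuous_on S (\<lambda>x. (f x, g x))"
  unfolding uniformly_continuous_on_def
proof (intro allI impI)
  fix e :: real assume "e > 0"
  then have "e / 2 > 0" by simp
  obtain d1 where d1: "d1 > 0" "\<And>x y. x \<in> S \<Longrightarrow> y \<in> S \<Longrightarrow> dist y x < d1 \<Longrightarrow> dist (f y) (f x) < e / 2"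
    using assms(1) \<open>e / 2 > 0\<close> unfolding uniformly_continuous_on_def by meson
  obtain d2 where d2: "d2 > 0" "\<And>x y. x \<in> S \<Longrightarrow> y \<in> S \<Longrightarrow> dist y x < d2 \<Longrightarrow> dist (g y) (g x) < e / 2"
    using assms(2) \<open>e / 2 > 0\<close> unfolding uniformly_continuous_on_def by meson
  have "dist (f y, g y) (f x, g x) < e" if "x \<in> S" "y \<in> S" "dist y x < min d1 d2" for x y
  proof -
    have "dist (f y, g y) (f x, g x) \<le> dist (f y) (f x) + dist (g y) (g x)"
      unfolding dist_Pair_Pair by (rule sqrt_sum_squares_le_sum) auto
    also have "\<dots> < e" using d1(2)[of x y] d2(2)[of x y] that by simp
    finally show ?thesis .
  qed
  then show "\<exists>d>0. \<forall>x\<in>S. \<forall>x'\<in>S. dist x' x < d \<longrightarrow> dist (f x', g x') (f x, g x) < e"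
    using d1(1) d2(1) by (intro exI[of _ "min d1 d2"]) auto
qed

lemma uniformly_continuous_on_compact_compose:
  fixes f :: "'a::metric_space \<Rightarrow> 'b::metric_space" and g :: "'b \<Rightarrow> 'c::metric_space"
  assumes "uniformly_continuous_on S f" "continuous_on K g" "compact K" "f ` S \<subseteq> K"
  shows "uniformly_continuous_on S (\<lambda>x. g (f x))"
proof -
  have "uniformly_continuous_on K g" using assms by (intro compact_uniformly_continuous)
  then have "uniformly_continuous_on (f ` S) g"
    using assms(4) unfolding uniformly_continuous_on_def by (meson subsetD)
  with assms(1) show ?thesis by (rule uniformly_continuous_on_compose)
qed

text \<open>Compactness is used twice: for \<open>edge_cos\<close> on a box of radii bounded away
  from zero, and for \<open>arccos\<close> on \<open>[-1, 1]\<close>. No bound on the derivative of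
  \<open>arccos\<close> enters, so the cosine may approach 1 or -1.\<close>

lemma uniformly_continuous_on_edge_angle:
  fixes x y z w :: "real \<Rightarrow> real"
  assumes uc: "uniformly_continuous_on T x" "uniformly_continuous_on T y"
      "uniformly_continuous_on T z" "uniformly_continuous_on T w"
    and \<delta>: "\<delta> > 0"
    and range: "\<And>t. t \<in> T \<Longrightarrow> x t \<in> {\<delta>..M}" "\<And>t. t \<in> T \<Longrightarrow> y t \<in> {\<delta>..M}"
      "\<And>t. t \<in> T \<Longrightarrow> z t \<in> {\<delta>..M}" "\<And>t. t \<in> T \<Longrightarrow> w t \<in> {\<delta>..M}"
    and cos: "\<And>t. t \<in> T \<Longrightarrow> edge_cos (x t) (y t) (z t) (w t) \<in> {-1..1}"
  shows "uniformly_continuous_on T (\<lambda>t. arccos (edge_cos (x t) (y t) (z t) (w t)))"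
proof -
  define K where "K = {\<delta>..M} \<times> {\<delta>..M} \<times> {\<delta>..M} \<times> {\<delta>..M}"
  have "continuous_on K (\<lambda>(a, b, c, d). edge_cos a b c d)"
  proof -
    have "2 * a * b * sqrt (edge_rad a b c d) \<noteq> 0" if "(a, b, c, d) \<in> K" for a b c d
      using that \<delta> edge_rad_pos[of a b c d] by (auto simp: K_def)
    then show ?thesis
      unfolding case_prod_beta edge_cos_def edge_num_def edge_rad_def
      by (intro continuous_intros) auto
  qed
  moreover have "compact K" unfolding K_def by (intro compact_Times) auto
  moreover have "uniformly_continuous_on T (\<lambda>t. (x t, y t, z t, w t))"
    using uc by (intro uniformly_continuous_on_Pair)
  moreover have "(\<lambda>t. (x t, y t, z t, w t)) ` T \<subseteq> K"
    using range by (auto simp: K_def)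
  ultimately have "uniformly_continuous_on T (\<lambda>t. edge_cos (x t) (y t) (z t) (w t))"
    using uniformly_continuous_on_compact_compose[of T "\<lambda>t. (x t, y t, z t, w t)" K
      "\<lambda>(a, b, c, d). edge_cos a b c d"] by simp
  then show ?thesis
    using cos by (intro uniformly_continuous_on_compact_compose[OF _ continuous_on_arccos']) auto
qed

text \<open>Three angles in \<open>[0, pi]\<close> minus \<open>pi\<close>; this crude range serves
  to bound the curvatures.\<close>

lemma solid_angle_bounds:
  fixes r :: "'v \<Rightarrow> real"
  assumes "card \<sigma> = 4" "i \<in> \<sigma>" and "\<And>m. m \<in> \<sigma> \<Longrightarrow> r m > 0" and "Q r \<sigma> > 0"
  shows "solid_angle r \<sigma> i \<in> {-pi..2 * pi}"
proof -
  obtain j k l where \<sigma>: "\<sigma> = {i, j, k, l}" and dist: "distinct [i, j, k, l]"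
    using assms(1,2) by (rule card_4_obtain)
  have q: "quad_Q (r i) (r j) (r k) (r l) > 0"
    using assms(4) by (simp only: \<sigma> Q_tetrahedron[OF dist])
  have q': "quad_Q (r i) (r k) (r j) (r l) > 0" "quad_Q (r i) (r l) (r j) (r k) > 0"
    using q by (simp_all add: quad_Q_def add_ac)
  have range: "arccos (edge_cos a b c d) \<in> {0..pi}"
    if "a > 0" "b > 0" "c > 0" "d > 0" "quad_Q a b c d > 0" for a b c d
    using edge_cos_bounds[OF that] by (simp add: arccos_lbound arccos_ubound)
  have pos: "r i > 0" "r j > 0" "r k > 0" "r l > 0" using assms(3) by (simp_all add: \<sigma>)
  note range[OF pos(1,2,3,4) q] range[OF pos(1,3,2,4) q'(1)] range[OF pos(1,4,2,3) q'(2)]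
  moreover have "solid_angle r \<sigma> i = arccos (edge_cos (r i) (r j) (r k) (r l))
     + arccos (edge_cos (r i) (r k) (r j) (r l)) + arccos (edge_cos (r i) (r l) (r j) (r k)) - pi"
    unfolding \<sigma> using assms(3,4) dist by (intro solid_angle_formula) (auto simp: \<sigma>)
  ultimately show ?thesis unfolding atLeastAtMost_iff by linarith
qed

text \<open>Scale invariance of the cosines transfers the regularity of the quotients
  \<open>r t m / R t\<close> to the angles, although the radii themselves may be unbounded.\<close>

lemma uniformly_continuous_on_solid_angle:
  fixes r :: "real \<Rightarrow> 'v \<Rightarrow> real"
  assumes card: "card \<sigma> = 4" "i \<in> \<sigma>"
    and pos: "\<And>t m. t \<in> T \<Longrightarrow> m \<in> \<sigma> \<Longrightarrow> r t m > 0"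
    and Q: "\<And>t. t \<in> T \<Longrightarrow> Q (r t) \<sigma> > 0"
    and R: "\<And>t. t \<in> T \<Longrightarrow> R t > 0"
    and uc: "\<And>m. m \<in> \<sigma> \<Longrightarrow> uniformly_continuous_on T (\<lambda>t. r t m / R t)"
    and \<delta>: "\<delta> > 0"
    and range: "\<And>t m. t \<in> T \<Longrightarrow> m \<in> \<sigma> \<Longrightarrow> r t m / R t \<in> {\<delta>..M}"
  shows "uniformly_continuous_on T (\<lambda>t. solid_angle (r t) \<sigma> i)"
proof -
  obtain j k l where \<sigma>: "\<sigma> = {i, j, k, l}" and dist: "distinct [i, j, k, l]"
    using card by (rule card_4_obtain)
  have angle: "uniformly_continuous_on T (\<lambda>t. arccos (edge_cos (r t a) (r t b) (r t c) (r t d)))"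
    if m: "a \<in> \<sigma>" "b \<in> \<sigma>" "c \<in> \<sigma>" "d \<in> \<sigma>" and "\<And>t. quad_Q (r t a) (r t b) (r t c) (r t d) = quad_Q (r t i) (r t j) (r t k) (r t l)" for a b c d
  proof -
    have cos: "edge_cos (r t a / R t) (r t b / R t) (r t c / R t) (r t d / R t)
      = edge_cos (r t a) (r t b) (r t c) (r t d)" if "t \<in> T" for t
      using R[OF that] by (rule edge_cos_scale)
    have q: "quad_Q (r t a) (r t b) (r t c) (r t d) > 0" if "t \<in> T" for t
      using Q[OF that] \<open>\<And>t. quad_Q (r t a) _ _ _ = _\<close> by (simp only: \<sigma> Q_tetrahedron[OF dist])
    have "uniformly_continuous_on T (\<lambda>t. arccos (edge_cos (r t a / R t) (r t b / R t) (r t c / R t) (r t d / R t)))"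
    proof (rule uniformly_continuous_on_edge_angle[OF uc uc uc uc \<delta>])
      fix t assume t: "t \<in> T"
      show "edge_cos (r t a / R t) (r t b / R t) (r t c / R t) (r t d / R t) \<in> {-1..1}"
        unfolding cos[OF t] using edge_cos_bounds[OF pos pos pos pos q[OF t], OF t m(1) t m(2) t m(3) t m(4)]
        by simp
    qed (use m range in auto)
    then show ?thesis
      using cos unfolding uniformly_continuous_on_def by (simp cong: ball_cong)
  qed
  have "uniformly_continuous_on T (\<lambda>t. arccos (edge_cos (r t i) (r t j) (r t k) (r t l))
     + arccos (edge_cos (r t i) (r t k) (r t j) (r t l)) + arccos (edge_cos (r t i) (r t l) (r t j) (r t k)) - pi)"
    by (intro uniformly_continuous_on_add uniformly_continuous_on_diff uniformly_continuous_on_const angle)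
      (auto simp: \<sigma> quad_Q_def add_ac)
  moreover have "solid_angle (r t) \<sigma> i = arccos (edge_cos (r t i) (r t j) (r t k) (r t l))
     + arccos (edge_cos (r t i) (r t k) (r t j) (r t l)) + arccos (edge_cos (r t i) (r t l) (r t j) (r t k)) - pi"
    if "t \<in> T" for t
    unfolding \<sigma> using pos Q that dist by (intro solid_angle_formula) (auto simp: \<sigma>)
  ultimately show ?thesis
    unfolding uniformly_continuous_on_def by (simp cong: ball_cong)
qed

subsection \<open>Convergence of dissipative quantities\<close>

lemma mean_value_within:
  fixes f f' :: "real \<Rightarrow> real"
  assumes "a < b" "{a..b} \<subseteq> X" and "\<And>t. t \<in> X \<Longrightarrow> (f has_real_derivative f' t) (at t within X)"
  shows "\<exists>\<xi>\<in>{a<..<b}. f b - f a = (b - a) * f' \<xi>"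
proof -
  have "\<exists>\<xi>\<in>{a<..<b}. f b - f a = f' \<xi> * (b - a)"
  proof (rule mvt_simple[OF \<open>a < b\<close>])
    fix x assume "a \<le> x" "x \<le> b"
    then have "(f has_real_derivative f' x) (at x within {a..b})"
      using has_field_derivative_subset[OF assms(3) assms(2)] assms(2) by auto
    then show "(f has_derivative (*) (f' x)) (at x within {a..b})"
      by (simp add: has_field_derivative_def)
  qed
  then show ?thesis by (simp only: mult.commute)
qed

text \<open>The function \<open>f\<close> is decreasing and bounded below. If \<open>h\<close> were
  large at a late time, uniform continuity would keep it large for a fixed duration, and
  \<open>f\<close> would lose more than it still has above its limit.\<close>

lemma dissipation_limit:
  fixes f f' h :: "real \<Rightarrow> real"
  assumes der: "\<And>t. t \<ge> 0 \<Longrightarrow> (f has_real_derivative f' t) (at t within {0..})"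
    and diss: "\<And>t. t \<ge> 0 \<Longrightarrow> f' t \<le> - (c * (h t)\<^sup>2)" and c: "c > 0"
    and lower: "\<And>t. t \<ge> 0 \<Longrightarrow> L0 \<le> f t"
    and uc: "uniformly_continuous_on {0..} h"
  shows "\<exists>L. (f \<longlongrightarrow> L) at_top" and "(h \<longlongrightarrow> 0) at_top"
proof -
  have mvt: "\<exists>\<xi>\<in>{s<..<t}. f t - f s = (t - s) * f' \<xi>" if "0 \<le> s" "s < t" for s t
    by (rule mean_value_within[where X = "{0..}"]) (use that der in auto)
  have anti: "f t \<le> f s" if "0 \<le> s" "s \<le> t" for s t
  proof (cases "s = t")
    case False
    with that obtain \<xi> where \<xi>: "\<xi> \<in> {s<..<t}" "f t - f s = (t - s) * f' \<xi>"
      using mvt[of s t] by auto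
    have "f' \<xi> \<le> 0" using diss[of \<xi>] \<xi> that c
      by (smt (verit) greaterThanLessThan_iff mult_nonneg_nonneg zero_le_power2)
    then have "(t - s) * f' \<xi> \<le> 0" using that by (simp add: mult_nonneg_nonpos)
    then show ?thesis using \<xi> by simp
  qed simp
  define L where "L = (INF t\<in>{0..}. f t)"
  have bdd: "bdd_below (f ` {0..})" using lower by (auto simp: bdd_below_def)
  have L: "L \<le> f t" if "t \<ge> 0" for t
    unfolding L_def using that by (intro cINF_lower[OF bdd]) auto
  have lim: "(f \<longlongrightarrow> L) at_top"
  proof (rule decreasing_tendsto)
    show "\<forall>\<^sub>F t in at_top. L \<le> f t"
      using eventually_ge_at_top[of 0] by eventually_elim (rule L)
    fix x assume "L < x"
    then obtain s where s: "s \<ge> 0" "f s < x"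
      unfolding L_def using cINF_less_iff[OF _ bdd] by auto
    show "\<forall>\<^sub>F t in at_top. f t < x"
      using eventually_ge_at_top[of s] by eventually_elim (use anti s in force)
  qed
  then show "\<exists>L. (f \<longlongrightarrow> L) at_top" ..
  show "(h \<longlongrightarrow> 0) at_top"
  proof (rule tendstoI)
    fix e :: real assume e: "e > 0"
    then have "e / 2 > 0" by simp
    then obtain d where d: "d > 0"
      "\<And>x y. x \<in> {0..} \<Longrightarrow> y \<in> {0..} \<Longrightarrow> dist y x < d \<Longrightarrow> dist (h y) (h x) < e / 2"
      using uc unfolding uniformly_continuous_on_def by meson
    \<comment> \<open>\<open>f\<close> decreases at least at the rate \<open>q\<close> wherever the
      modulus of \<open>h\<close> is at least \<open>e / 2\<close>.\<close>
    define q where "q = c * (e / 2)\<^sup>2"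
    have q: "q > 0" using c e by (simp add: q_def)
    \<comment> \<open>Eventually less is left above \<open>L\<close> than one stretch of length
      \<open>d / 2\<close> with \<open>h\<close> large would consume.\<close>
    have "\<forall>\<^sub>F t in at_top. f t < L + d / 2 * q"
      using lim d q by (intro order_tendstoD(2)) auto
    then show "\<forall>\<^sub>F t in at_top. dist (h t) 0 < e"
      using eventually_ge_at_top[of 0]
    proof eventually_elim
      case (elim t)
      show ?case
      proof (rule ccontr)
        assume "\<not> ?case"
        then have he: "\<bar>h t\<bar> \<ge> e" by simp
        \<comment> \<open>The mean value theorem takes the place of integrating \<open>f'\<close>:
          one point of the stretch, where \<open>h\<close> is still at least \<open>e / 2\<close> in
          modulus, decides.\<close>
        obtain \<xi> where \<xi>: "\<xi> \<in> {t<..<t + d / 2}" "f (t + d / 2) - f t = d / 2 * f' \<xi>"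
          using mvt[of t "t + d / 2"] elim d by auto
        have "dist (h \<xi>) (h t) < e / 2"
          using \<xi> elim d(1) by (intro d(2)) (auto simp: dist_real_def)
        then have "\<bar>h \<xi>\<bar> \<ge> e / 2" using he unfolding dist_real_def by arith
        then have "(e / 2)\<^sup>2 \<le> (h \<xi>)\<^sup>2"
          using e by (metis abs_of_pos abs_le_square_iff half_gt_zero)
        then have "q \<le> c * (h \<xi>)\<^sup>2" unfolding q_def using c by simp
        then have "f' \<xi> \<le> - q" using diss[of \<xi>] \<xi> elim by simp
        then have "d / 2 * f' \<xi> \<le> d / 2 * (- q)" using d by (intro mult_left_mono) auto
        then have "f (t + d / 2) \<le> f t - d / 2 * q" using \<xi> by simp
        moreover have "L \<le> f (t + d / 2)" using elim d by (intro L) simp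
        ultimately show False using elim by simp
      qed
    qed
  qed
qed

lemma uniformly_continuous_on_bounded_derivative:
  fixes f f' :: "real \<Rightarrow> real"
  assumes "\<And>t. t \<ge> 0 \<Longrightarrow> (f has_real_derivative f' t) (at t within {0..})"
    and "\<And>t. t \<ge> 0 \<Longrightarrow> \<bar>f' t\<bar> \<le> B"
  shows "uniformly_continuous_on {0..} f"
proof -
  have "dist (f x) (f y) \<le> B * dist x y" if "x \<ge> 0" "y \<ge> 0" for x y
    using field_differentiable_bound[of "{0..}" f f' B x y] assms that by (auto simp: dist_norm)
  moreover have "B \<ge> 0" using assms(2)[of 0] by simp
  ultimately have "B-lipschitz_on {0..} f" by (auto intro!: lipschitz_onI)
  then show ?thesis by (rule lipschitz_on_uniformly_continuous)
qed

section \<open>Evolution of the normalized radii and of the average curvature\<close>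

lemma normalized_flow_derivative:
  fixes r K :: "real \<Rightarrow> 'v \<Rightarrow> real"
  assumes V: "finite V" "i \<in> V" and pos: "\<And>i. i \<in> V \<Longrightarrow> r t i > 0"
    and flow: "\<And>i. i \<in> V \<Longrightarrow> ((\<lambda>s. r s i) has_real_derivative - K t i * r t i) (at t within X)"
  shows "((\<lambda>s. r s i / (\<Sum>j\<in>V. r s j)) has_real_derivative
     - (K t i - (\<Sum>j\<in>V. K t j * r t j) / (\<Sum>j\<in>V. r t j)) * (r t i / (\<Sum>j\<in>V. r t j))) (at t within X)"
proof -
  define R F where "R = (\<Sum>j\<in>V. r t j)" and "F = (\<Sum>j\<in>V. K t j * r t j)"
  have R: "R > 0" unfolding R_def using V pos by (intro sum_pos) auto
  \<comment> \<open>The total of the radii has logarithmic derivative \<open>- F / R\<close>, so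
    dividing by it subtracts the average from each curvature.\<close>
  have "((\<lambda>s. \<Sum>j\<in>V. r s j) has_real_derivative (\<Sum>j\<in>V. - K t j * r t j)) (at t within X)"
    using flow by (intro DERIV_sum)
  also have "(\<Sum>j\<in>V. - K t j * r t j) = - F" by (simp add: F_def sum_negf)
  finally have "((\<lambda>s. r s i / (\<Sum>j\<in>V. r s j)) has_real_derivative
      (- K t i * r t i * R - r t i * - F) / (R * R)) (at t within X)"
    using DERIV_divide[OF flow[OF V(2)], of "\<lambda>s. \<Sum>j\<in>V. r s j" "- F"] R by (simp only: R_def less_imp_neq[symmetric] not_False_eq_True)
  moreover have "(- K t i * r t i * R - r t i * - F) / (R * R) = - (K t i - F / R) * (r t i / R)"
    using R by (simp add: field_simps)
  ultimately show ?thesis by (simp add: R_def F_def)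
qed

text \<open>The quotient rule gives minus the mean of the squared curvatures plus the square of
  their mean, the weights being the shares of the radii; this is minus a variance.\<close>

lemma average_derivative:
  fixes r K :: "real \<Rightarrow> 'v \<Rightarrow> real"
  assumes V: "finite V" "V \<noteq> {}" and pos: "\<And>i. i \<in> V \<Longrightarrow> r t i > 0"
    and flow: "\<And>i. i \<in> V \<Longrightarrow> ((\<lambda>s. r s i) has_real_derivative - K t i * r t i) (at t within X)"
    and total: "((\<lambda>s. \<Sum>i\<in>V. K s i * r s i) has_real_derivative - (\<Sum>i\<in>V. (K t i)\<^sup>2 * r t i)) (at t within X)"
    and k: "k = (\<lambda>s. (\<Sum>i\<in>V. K s i * r s i) / (\<Sum>i\<in>V. r s i))"
  shows "(k has_real_derivative - (\<Sum>i\<in>V. (K t i - k t)\<^sup>2 * (r t i / (\<Sum>j\<in>V. r t j)))) (at t within X)"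
proof -
  define R F G where "R = (\<Sum>j\<in>V. r t j)" and "F = (\<Sum>j\<in>V. K t j * r t j)"
    and "G = (\<Sum>i\<in>V. (K t i)\<^sup>2 * r t i)"
  have R: "R > 0" unfolding R_def using V pos by (intro sum_pos) auto
  have kt: "k t = F / R" by (simp add: k F_def R_def)
  have "((\<lambda>s. \<Sum>j\<in>V. r s j) has_real_derivative (\<Sum>j\<in>V. - K t j * r t j)) (at t within X)"
    using flow by (intro DERIV_sum)
  also have "(\<Sum>j\<in>V. - K t j * r t j) = - F" by (simp add: F_def sum_negf)
  finally have "(k has_real_derivative (- G * R - F * - F) / (R * R)) (at t within X)"
    using DERIV_divide[OF total, of "\<lambda>s. \<Sum>j\<in>V. r s j" "- F"] R
    unfolding k by (simp only: R_def F_def G_def less_imp_neq[symmetric] not_False_eq_True)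
  moreover have "(\<Sum>i\<in>V. (K t i - k t)\<^sup>2 * (r t i / R)) = (G - 2 * k t * F + (k t)\<^sup>2 * R) / R"
  proof -
    have "(\<Sum>i\<in>V. (K t i - k t)\<^sup>2 * (r t i / R)) = (\<Sum>i\<in>V. (K t i - k t)\<^sup>2 * r t i) / R"
      by (simp add: sum_divide_distrib)
    also have "(\<Sum>i\<in>V. (K t i - k t)\<^sup>2 * r t i)
        = (\<Sum>i\<in>V. (K t i)\<^sup>2 * r t i - 2 * k t * (K t i * r t i) + (k t)\<^sup>2 * r t i)"
      by (intro sum.cong refl) (simp add: power2_diff algebra_simps)
    also have "\<dots> = G - 2 * k t * F + (k t)\<^sup>2 * R"
      by (simp add: R_def F_def G_def sum.distrib sum_subtractf sum_distrib_left)
    finally show ?thesis .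
  qed
  moreover have "(- G * R - F * - F) / (R * R) = - ((G - 2 * k t * F + (k t)\<^sup>2 * R) / R)"
    unfolding kt using R by (simp add: field_simps power2_eq_square)
  ultimately show ?thesis by (simp add: R_def)
qed

lemma weighted_average_le:
  fixes K r :: "'v \<Rightarrow> real"
  assumes "finite V" "V \<noteq> {}" "\<And>i. i \<in> V \<Longrightarrow> r i > 0" "\<And>i. i \<in> V \<Longrightarrow> \<bar>K i\<bar> \<le> B"
  shows "\<bar>(\<Sum>i\<in>V. K i * r i) / (\<Sum>i\<in>V. r i)\<bar> \<le> B"
proof -
  have R: "(\<Sum>i\<in>V. r i) > 0" using assms by (intro sum_pos) auto
  have "\<bar>\<Sum>i\<in>V. K i * r i\<bar> \<le> (\<Sum>i\<in>V. \<bar>K i * r i\<bar>)" by (rule sum_abs)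
  also have "\<dots> \<le> (\<Sum>i\<in>V. B * r i)"
    using assms by (intro sum_mono) (simp add: abs_mult mult_right_mono less_imp_le)
  also have "\<dots> = B * (\<Sum>i\<in>V. r i)" by (simp add: sum_distrib_left)
  finally show ?thesis using R by (simp add: field_simps)
qed

subsection \<open>The combinatorial Yamabe flow\<close>

text \<open>Counting incident pairs of vertices and tetrahedra turns the total curvature into
  \<open>4 * pi\<close> times the sum of the radii minus a sum over tetrahedra, and in each of these
  the solid angles behave like constants.\<close>

lemma total_curvature_derivative:
  fixes r :: "real \<Rightarrow> 'v \<Rightarrow> real"
  assumes S: "finite S" and V: "finite (vertices S)" "\<And>\<sigma>. \<sigma> \<in> tetrahedra S \<Longrightarrow> \<sigma> \<subseteq> vertices S"
    and t: "t \<in> X"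
    and pos: "\<And>s m. s \<in> X \<Longrightarrow> m \<in> vertices S \<Longrightarrow> r s m > 0"
    and Q: "\<And>s \<sigma>. s \<in> X \<Longrightarrow> \<sigma> \<in> tetrahedra S \<Longrightarrow> Q (r s) \<sigma> > 0"
    and d: "\<And>m. m \<in> vertices S \<Longrightarrow>
      ((\<lambda>s. r s m) has_real_derivative p m * r t m) (at t within X)"
  shows "((\<lambda>s. \<Sum>i\<in>vertices S. curvature S (r s) i * r s i) has_real_derivative
     (\<Sum>i\<in>vertices S. curvature S (r t) i * (p i * r t i))) (at t within X)"
proof -
  have fin: "finite (tetrahedra S)" using S by (simp add: simplices_of_dim_def)
  have sum: "(\<Sum>i\<in>vertices S. curvature S q i * w i) = 4 * pi * (\<Sum>i\<in>vertices S. w i)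
      - (\<Sum>\<sigma>\<in>tetrahedra S. \<Sum>i\<in>\<sigma>. solid_angle q \<sigma> i * w i)" for q w :: "'v \<Rightarrow> real"
  proof -
    have "(\<Sum>i\<in>vertices S. \<Sum>\<sigma> | \<sigma> \<in> tetrahedra S \<and> i \<in> \<sigma>. solid_angle q \<sigma> i * w i)
      = (\<Sum>\<sigma>\<in>tetrahedra S. \<Sum>i | i \<in> vertices S \<and> i \<in> \<sigma>. solid_angle q \<sigma> i * w i)"
      by (rule sum.swap_restrict[OF V(1) fin])
    also have "\<dots> = (\<Sum>\<sigma>\<in>tetrahedra S. \<Sum>i\<in>\<sigma>. solid_angle q \<sigma> i * w i)"
    proof (intro sum.cong refl)
      fix \<sigma> assume "\<sigma> \<in> tetrahedra S"
      then show "{i. i \<in> vertices S \<and> i \<in> \<sigma>} = \<sigma>" using V(2) by blast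
    qed
    finally show ?thesis
      by (simp add: curvature_def left_diff_distrib sum_subtractf sum_distrib_left sum_distrib_right)
  qed
  have tet: "((\<lambda>s. \<Sum>m\<in>\<sigma>. solid_angle (r s) \<sigma> m * r s m) has_real_derivative
     (\<Sum>m\<in>\<sigma>. solid_angle (r t) \<sigma> m * (p m * r t m))) (at t within X)" if "\<sigma> \<in> tetrahedra S" for \<sigma>
    using that V(2)[OF that] pos Q d t
    by (intro weighted_solid_angle_derivative) (auto simp: simplices_of_dim_def)
  have total: "((\<lambda>s. \<Sum>\<sigma>\<in>tetrahedra S. \<Sum>m\<in>\<sigma>. solid_angle (r s) \<sigma> m * r s m) has_real_derivative
     (\<Sum>\<sigma>\<in>tetrahedra S. \<Sum>m\<in>\<sigma>. solid_angle (r t) \<sigma> m * (p m * r t m))) (at t within X)"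
    by (rule DERIV_sum) (rule tet)
  have "((\<lambda>s. \<Sum>i\<in>vertices S. r s i) has_real_derivative (\<Sum>i\<in>vertices S. p i * r t i)) (at t within X)"
    by (rule DERIV_sum) (rule d)
  from DERIV_diff[OF DERIV_cmult[OF this] total] show ?thesis unfolding sum .
qed

lemma finite_vertices:
  assumes "finite S"
  shows "finite (vertices S)"
proof -
  have "(\<lambda>i. {i}) ` vertices S \<subseteq> S" by (auto simp: vertices_def)
  then have "finite ((\<lambda>i. {i}) ` vertices S)" using assms by (rule finite_subset)
  then show ?thesis by (rule finite_imageD) simp
qed

lemma simplex_subset_vertices:
  assumes "abstract_complex S" "\<sigma> \<in> S"
  shows "\<sigma> \<subseteq> vertices S"
proof
  fix i assume "i \<in> \<sigma>"
  then have "{i} \<noteq> {}" "{i} \<subseteq> \<sigma>" by auto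
  then show "i \<in> vertices S"
    using assms unfolding abstract_complex_def vertices_def by blast
qed

theorem proposition6:
  fixes S :: "'v set set" and r :: "real \<Rightarrow> 'v \<Rightarrow> real"
  assumes "finite S" and "complex_of_dim S 3"
    and "nonsingular_solution S r"
  shows "\<exists>k_inf::real.
    ((\<lambda>t. average_scalar_curvature S (r t)) \<longlongrightarrow> k_inf) at_top \<and>
    (\<forall>i\<in>vertices S. ((\<lambda>t. curvature S (r t) i) \<longlongrightarrow> k_inf) at_top)"
proof -
  define V where "V = vertices S"
  define K where "K = (\<lambda>t. curvature S (r t))"
  define R where "R = (\<lambda>t. \<Sum>j\<in>V. r t j)"
  define k where "k = (\<lambda>t. (\<Sum>i\<in>V. K t i * r t i) / (\<Sum>i\<in>V. r t i))"
  have cpx: "abstract_complex S" "tetrahedra S \<noteq> {}"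
    using assms(2) by (auto simp: complex_of_dim_def)
  have finV: "finite V" unfolding V_def using assms(1) by (rule finite_vertices)
  have tet: "\<sigma> \<subseteq> V" "card \<sigma> = 4" if "\<sigma> \<in> tetrahedra S" for \<sigma>
    using that simplex_subset_vertices[OF cpx(1)] by (auto simp: V_def simplices_of_dim_def)
  have fintet: "finite (tetrahedra S)" using assms(1) by (simp add: simplices_of_dim_def)
  \<comment> \<open>The complex has a tetrahedron, hence a vertex.\<close>
  have neV: "V \<noteq> {}" using cpx(2) tet by fastforce
  have pos: "r t i > 0" if "t \<ge> 0" "i \<in> V" for t i
    using assms(3) that by (simp add: nonsingular_solution_def metric_structure_def V_def)
  have Q: "Q (r t) \<sigma> > 0" if "t \<ge> 0" "\<sigma> \<in> tetrahedra S" for t \<sigma>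
    using assms(3) that by (simp add: nonsingular_solution_def)
  have flow: "((\<lambda>s. r s i) has_real_derivative - K t i * r t i) (at t within {0..})"
    if "t \<ge> 0" "i \<in> V" for t i
    using assms(3) that by (simp add: nonsingular_solution_def yamabe_flow_def V_def K_def)
  obtain \<delta> where \<delta>: "\<delta> > 0" "\<And>t i. t \<ge> 0 \<Longrightarrow> i \<in> V \<Longrightarrow> r t i / R t \<ge> \<delta>"
    using assms(3) unfolding nonsingular_solution_def V_def R_def by blast
  have R: "R t > 0" if "t \<ge> 0" for t
    unfolding R_def using finV neV pos that by (intro sum_pos) auto
  have x_le: "r t i / R t \<le> 1" if "t \<ge> 0" "i \<in> V" for t i
    using R[OF that(1)] member_le_sum[of i V "r t"] finV that pos by (simp add: R_def less_imp_le)
  \<comment> \<open>\<open>4 * pi\<close> from the definition of the curvature, plus at most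
    \<open>2 * pi\<close> in modulus for each tetrahedron.\<close>
  define B where "B = 4 * pi + 2 * pi * card (tetrahedra S)"
  have B0: "B \<ge> 0" unfolding B_def by simp
  have K_le: "\<bar>K t i\<bar> \<le> B" if "t \<ge> 0" "i \<in> V" for t i
  proof -
    have "\<bar>\<Sum>\<sigma> | \<sigma> \<in> tetrahedra S \<and> i \<in> \<sigma>. solid_angle (r t) \<sigma> i\<bar>
        \<le> (\<Sum>\<sigma> | \<sigma> \<in> tetrahedra S \<and> i \<in> \<sigma>. \<bar>solid_angle (r t) \<sigma> i\<bar>)" by (rule sum_abs)
    also have "\<dots> \<le> (\<Sum>\<sigma> | \<sigma> \<in> tetrahedra S \<and> i \<in> \<sigma>. 2 * pi)"
    proof (rule sum_mono)
      fix \<sigma> assume "\<sigma> \<in> {\<sigma> \<in> tetrahedra S. i \<in> \<sigma>}"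
      then have "solid_angle (r t) \<sigma> i \<in> {-pi..2 * pi}"
        using tet[of \<sigma>] pos Q that by (intro solid_angle_bounds) auto
      then show "\<bar>solid_angle (r t) \<sigma> i\<bar> \<le> 2 * pi" by (simp add: abs_le_iff)
    qed
    also have "\<dots> \<le> (\<Sum>\<sigma>\<in>tetrahedra S. 2 * pi)"
      using fintet by (intro sum_mono2) auto
    also have "\<dots> = 2 * pi * card (tetrahedra S)" by simp
    finally show ?thesis
      unfolding K_def curvature_def B_def using pi_gt_zero by linarith
  qed
  have k_le: "\<bar>k t\<bar> \<le> B" if "t \<ge> 0" for t
    unfolding k_def
    by (rule weighted_average_le[OF finV neV pos[OF that] K_le[OF that]])
  \<comment> \<open>The logarithmic derivative of a share is \<open>- (K t i - k t)\<close>, bounded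
    by \<open>2 * B\<close>, and the share is at most 1.\<close>
  have x_uc: "uniformly_continuous_on {0..} (\<lambda>t. r t i / R t)" if i: "i \<in> V" for i
  proof (rule uniformly_continuous_on_bounded_derivative)
    fix t :: real assume t: "t \<ge> 0"
    show "((\<lambda>t. r t i / R t) has_real_derivative - (K t i - k t) * (r t i / R t)) (at t within {0..})"
      unfolding R_def k_def by (rule normalized_flow_derivative[where r = r and K = K, OF finV i pos[OF t] flow[OF t]])
    have "\<bar>K t i - k t\<bar> * \<bar>r t i / R t\<bar> \<le> (2 * B) * 1"
    proof (rule mult_mono)
      show "\<bar>K t i - k t\<bar> \<le> 2 * B" using K_le[OF t i] k_le[OF t] by linarith
      show "\<bar>r t i / R t\<bar> \<le> 1" using x_le[OF t i] \<delta>(2)[OF t i] \<delta>(1) by linarith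
    qed (use B0 in auto)
    then show "\<bar>- (K t i - k t) * (r t i / R t)\<bar> \<le> 2 * B"
      by (simp only: abs_mult abs_minus_cancel mult_1_right)
  qed
  \<comment> \<open>The shares stay in the compact interval from \<open>\<delta>\<close> to 1; the
    lower bound from nonsingularity keeps the cosines away from the boundary of the orthant.\<close>
  have K_uc: "uniformly_continuous_on {0..} (\<lambda>t. K t i)" if i: "i \<in> V" for i
    unfolding K_def curvature_def
  proof (intro uniformly_continuous_on_diff uniformly_continuous_on_const uniformly_continuous_on_sum)
    fix \<sigma> assume "\<sigma> \<in> {\<sigma> \<in> tetrahedra S. i \<in> \<sigma>}"
    then have \<sigma>: "\<sigma> \<in> tetrahedra S" "i \<in> \<sigma>" by auto
    show "uniformly_continuous_on {0..} (\<lambda>t. solid_angle (r t) \<sigma> i)"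
    proof (rule uniformly_continuous_on_solid_angle[OF tet(2)[OF \<sigma>(1)] \<sigma>(2), where R = R and \<delta> = \<delta> and M = 1])
    qed (use tet(1)[OF \<sigma>(1)] \<sigma> pos Q R x_uc \<delta> x_le in auto)
  qed
  have k_der: "(k has_real_derivative - (\<Sum>i\<in>V. (K t i - k t)\<^sup>2 * (r t i / R t))) (at t within {0..})"
    if t: "t \<ge> 0" for t
    unfolding R_def
  proof (rule average_derivative[where r = r and K = K, OF finV neV pos[OF t] flow[OF t] _ k_def])
    \<comment> \<open>Along the flow the logarithmic derivative of the radius at \<open>i\<close> is
      \<open>- K t i\<close>.\<close>
    have "((\<lambda>s. \<Sum>i\<in>V. K s i * r s i) has_real_derivative (\<Sum>i\<in>V. K t i * (- K t i * r t i))) (at t within {0..})"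
      unfolding V_def K_def
    proof (rule total_curvature_derivative)
      show "finite (vertices S)" using finV by (simp add: V_def)
    qed (use assms(1) tet pos Q flow t in \<open>auto simp: V_def K_def\<close>)
    then show "((\<lambda>s. \<Sum>i\<in>V. K s i * r s i) has_real_derivative - (\<Sum>i\<in>V. (K t i)\<^sup>2 * r t i)) (at t within {0..})"
      by (simp add: power2_eq_square sum_negf mult.assoc)
  qed
  have k_uc: "uniformly_continuous_on {0..} k"
  proof (rule uniformly_continuous_on_bounded_derivative[OF k_der])
    fix t :: real assume t: "t \<ge> 0"
    have "\<bar>\<Sum>i\<in>V. (K t i - k t)\<^sup>2 * (r t i / R t)\<bar> \<le> (\<Sum>i\<in>V. \<bar>(K t i - k t)\<^sup>2 * (r t i / R t)\<bar>)"
      by (rule sum_abs)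
    also have "\<dots> \<le> (\<Sum>i\<in>V. (2 * B)\<^sup>2 * 1)"
    proof (rule sum_mono)
      fix i assume i: "i \<in> V"
      have "\<bar>(K t i - k t)\<^sup>2\<bar> * \<bar>r t i / R t\<bar> \<le> (2 * B)\<^sup>2 * 1"
      proof (rule mult_mono)
        have "\<bar>K t i - k t\<bar> \<le> 2 * B" using K_le[OF t i] k_le[OF t] by linarith
        then show "\<bar>(K t i - k t)\<^sup>2\<bar> \<le> (2 * B)\<^sup>2" using power_mono[of "\<bar>K t i - k t\<bar>" "2 * B" 2] by simp
        show "\<bar>r t i / R t\<bar> \<le> 1" using x_le[OF t i] \<delta>(2)[OF t i] \<delta>(1) by linarith
      qed auto
      then show "\<bar>(K t i - k t)\<^sup>2 * (r t i / R t)\<bar> \<le> (2 * B)\<^sup>2 * 1" by (simp only: abs_mult)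
    qed
    finally show "\<bar>- (\<Sum>i\<in>V. (K t i - k t)\<^sup>2 * (r t i / R t))\<bar> \<le> (\<Sum>i\<in>V. (2 * B)\<^sup>2 * 1)"
      by simp
  qed
  \<comment> \<open>All terms of the variance except that of \<open>j\<close> are dropped, and its
    weight is at least \<open>\<delta>\<close>; this gives the dissipation constant.\<close>
  have diss: "- (\<Sum>i\<in>V. (K t i - k t)\<^sup>2 * (r t i / R t)) \<le> - (\<delta> * (K t j - k t)\<^sup>2)"
    if t: "t \<ge> 0" and j: "j \<in> V" for t j
  proof -
    have x0: "r t i / R t \<ge> 0" if "i \<in> V" for i using \<delta>(2)[OF t that] \<delta>(1) by linarith
    have "\<delta> * (K t j - k t)\<^sup>2 \<le> (K t j - k t)\<^sup>2 * (r t j / R t)"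
      using mult_left_mono[OF \<delta>(2)[OF t j], of "(K t j - k t)\<^sup>2"] by (simp add: mult.commute)
    also have "\<dots> \<le> (\<Sum>i\<in>V. (K t i - k t)\<^sup>2 * (r t i / R t))"
      using finV j x0 by (intro member_le_sum mult_nonneg_nonneg) auto
    finally show ?thesis by simp
  qed
  have lower: "- B \<le> k t" if "t \<ge> 0" for t using k_le[OF that] by linarith
  have h_uc: "uniformly_continuous_on {0..} (\<lambda>t. K t i - k t)" if "i \<in> V" for i
    using K_uc[OF that] k_uc by (rule uniformly_continuous_on_diff)
  \<comment> \<open>The limit of \<open>k\<close> comes from the dissipation at any one vertex;
    every curvature is then compared with this same \<open>k\<close>.\<close>
  obtain j where j: "j \<in> V" using neV by blast
  obtain L where L: "(k \<longlongrightarrow> L) at_top"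
    using dissipation_limit(1)[OF k_der diss[OF _ j] \<delta>(1) lower h_uc[OF j]] by blast
  have "((\<lambda>t. K t i) \<longlongrightarrow> L) at_top" if "i \<in> V" for i
    using tendsto_add[OF dissipation_limit(2)[OF k_der diss[OF _ that] \<delta>(1) lower h_uc[OF that]] L] by simp
  with L show ?thesis
    unfolding average_scalar_curvature_def k_def K_def V_def by blast
qed

end
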